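(* Consider the SC-ABD algorithm (described in the context) running in an asynchronous message-passing system of $n$ processes with reliable links, in which processes may crash (crash-stop) and at most $f$ processes are faulty in any execution, where $f < n/2$. Then SC-ABD is a correct implementation of sequentially consistent distributed shared memory, i.e., it satisfies both: (Termination) if a correct process invokes an operation, then that operation eventually completes; and (Sequential Consistency) every (complete) history corresponding to an execution of the algorithm is sequentially consistent.
   Context: System model: $n$ processes $p_1,\dots,p_n$, $\Pi=\{1,\dots,n\}$, asynchronous, communicating over reliable point-to-point links. A process is correct if it never crashes, otherwise faulty; a crashed process stops taking steps forever. At most $f<n/2$ processes are faulty in any execution. Shared memory: a collection of read/write registers, each holding an integer, initially $0$. Operations are READ($r$) (returns a value) and WRITE($r,v$) (returns OK). Each process has at most one outstanding operation at a time. A history is the sequence of invocation and response events of operations, ordered by the real time at which they occur; only complete histories (every invoked operation has its response) are considered. $H|p_i$ denotes the subsequence of events at $p_i$. A history is sequential if it starts with an invocation and each invocation (except possibly the last) is immediately followed by its matching response; histories considered are well-formed (each $H|p_i$ is sequential). $H\simeq H'$ (equivalent) iff $H|p_i=H'|p_i$ for all $i$. A sequential history is legal if every read of a register returns the value of the closest preceding write to that register in the sequence, or $0$ if none. $H$ is sequentially consistent iff there exists a legal sequential history $S$ with $S\simeq H$. Algorithm SC-ABD (code for $p_i$). Local variables: logical clock $lt$ (initially $0$); request id $rid$ (initially $0$); map $tvps$ from registers to timestamp-value pairs, initially $((0,0),0)$ for every register; set $responses$ (initially empty); boolean $reading$; temporaries $rreg,rval$. Timestamps are pairs (integer, process id),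 compared lexicographically; timestamp-value pairs are compared by their timestamp (then value). Every message carries the sender's current $lt$; "bcast $m$" means send $m$ to every $p_j$, $j\in\Pi$ (including itself). Handlers: - READ($r$) invoked: $lt\gets lt+1$; $reading\gets true$; $rreg\gets r$; $rid\gets rid+1$; bcast ("query", $lt$, $rid$, $r$). - On ("query", $lt'$, $rid'$, $r$) from $p_j$: $lt\gets\max(lt,lt')+1$; send ("response", $lt$, $rid'$, $tvps[r]$) to $p_j$. - On ("response", $lt'$, $rid'$, $tsv'$) from $p_j$ with $rid=rid'$: $lt\gets\max(lt,lt')+1$; $responses\gets responses\cup\{(tsv',j)\}$; if $|responses|=\lfloor n/2\rfloor+1$: let $tsv=(ts,rval)$ be the pair with maximal timestamp among the received ones; $responses\gets\{\}$; $rid\gets rid+1$; bcast ("update", $lt$, $rid$, $rreg$, $tsv$). - WRITE($r,v$) invoked: $lt\gets lt+1$; $reading\gets false$; $tsv\gets((lt,i),v)$; $rid\gets rid+1$; bcast ("update", $lt$, $rid$, $r$, $tsv$). - On ("update", $lt'$, $rid'$, $r$, $tsv'$) from $p_j$: $lt\gets\max(lt,lt')+1$; $tvps[r]\gets\max(tvps[r],tsv')$; send ("ack", $lt$, $rid'$) to $p_j$. - On ("ack", $lt'$, $rid'$) from $p_j$ with $rid=rid'$: $lt\gets\max(lt,lt')+1$; $responses\gets responses\cup\{j\}$; if $|responses|=\lfloor n/2\rfloor+1$: $responses\gets\{\}$; $rid\gets rid+1$; if $reading$ then return $rval$ else return OK. *)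

theory Defs
  imports Main "HOL-Library.Multiset" "HOL-Library.Product_Lexorder"
begin

type_synonym proc = nat   (* process ids; the processes are 1..n *)
type_synonym reg = nat
type_synonym val = int
type_synonym ts = "nat \<times> proc"   (* timestamps, compared lexicographically *)
type_synonym tsv = "ts \<times> val"    (* timestamp-value pairs, compared lexicographically *)

datatype op = Read reg | Write reg val
datatype result = RVal val | ROK
datatype event = Inv proc op | Res proc result

fun ev_proc :: "event \<Rightarrow> proc" where
  "ev_proc (Inv i _) = i"
| "ev_proc (Res i _) = i"

fun is_inv :: "event \<Rightarrow> bool" where
  "is_inv (Inv _ _) = True"
| "is_inv (Res _ _) = False"

fun is_res :: "event \<Rightarrow> bool" where
  "is_res (Inv _ _) = False"
| "is_res (Res _ _) = True"

definition proj :: "event list \<Rightarrow> proc \<Rightarrow> event list" where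
  "proj H i = filter (\<lambda>e. ev_proc e = i) H"

definition equiv_hist :: "event list \<Rightarrow> event list \<Rightarrow> bool" where
  "equiv_hist H H' \<longleftrightarrow> (\<forall>i. proj H i = proj H' i)"

definition complete_hist :: "event list \<Rightarrow> bool" where
  "complete_hist H \<longleftrightarrow>
     (\<forall>k < length H. is_inv (H ! k) \<longrightarrow>
        (\<exists>k'. k < k' \<and> k' < length H \<and> is_res (H ! k') \<and> ev_proc (H ! k') = ev_proc (H ! k) \<and>
              (\<forall>k''. k < k'' \<and> k'' < k' \<longrightarrow> ev_proc (H ! k'') \<noteq> ev_proc (H ! k))))"

definition sequential_hist :: "event list \<Rightarrow> bool" where
  "sequential_hist S \<longleftrightarrow>
     (\<forall>k < length S. (even k \<longrightarrow> is_inv (S ! k)) \<and>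
        (odd k \<longrightarrow> is_res (S ! k) \<and> ev_proc (S ! k) = ev_proc (S ! (k - 1))))"

fun last_write :: "reg \<Rightarrow> event list \<Rightarrow> val" where
  "last_write r [] = 0"
| "last_write r (e # es) =
     (case e of Inv _ (Write r' v) \<Rightarrow> if r' = r then v else last_write r es
              | _ \<Rightarrow> last_write r es)"

definition legal_hist :: "event list \<Rightarrow> bool" where
  "legal_hist S \<longleftrightarrow>
     (\<forall>k r. Suc k < length S \<longrightarrow> (\<exists>i. S ! k = Inv i (Read r)) \<longrightarrow>
        (\<exists>i. S ! Suc k = Res i (RVal (last_write r (rev (take k S))))))"

definition seq_consistent :: "event list \<Rightarrow> bool" where
  "seq_consistent H \<longleftrightarrow> (\<exists>S. sequential_hist S \<and> legal_hist S \<and> equiv_hist S H)"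

text \<open>Message payloads; the first nat is the sender's logical clock lt, the second the request id.\<close>
datatype msg_body =
    Query nat nat reg
  | Response nat nat tsv
  | Update nat nat reg tsv
  | Ack nat nat

datatype msg = Msg (src: proc) (dst: proc) (body: msg_body)

text \<open>Elements of the set responses: (tsv, j) pairs from responses, or j from acks.\<close>
datatype resp = RespQ tsv proc | RespA proc

record lstate =
  lt :: nat
  rid :: nat
  tvps :: "reg \<Rightarrow> tsv"
  responses :: "resp set"
  reading :: bool
  rreg :: reg
  rval :: val
  busy :: bool   (* bookkeeping: the process has an outstanding operation *)

definition init_lstate :: lstate where
  "init_lstate = \<lparr>lt = 0, rid = 0, tvps = (\<lambda>_. ((0, 0), 0)), responses = {},
                  reading = False, rreg = 0, rval = 0, busy = False\<rparr>"

definition bcast :: "nat \<Rightarrow> proc \<Rightarrow> msg_body \<Rightarrow> msg multiset" where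
  "bcast n i b = mset (map (\<lambda>j. Msg i j b) [1..<Suc n])"

text \<open>handle n i j b s: process i (state s) receives payload b from process j.
  Returns new state, messages sent, and possibly an operation result.\<close>
fun handle :: "nat \<Rightarrow> proc \<Rightarrow> proc \<Rightarrow> msg_body \<Rightarrow> lstate \<Rightarrow> lstate \<times> msg multiset \<times> result option" where
  "handle n i j (Query l r' x) s =
     (let s1 = s\<lparr>lt := max (lt s) l + 1\<rparr>
      in (s1, {#Msg i j (Response (lt s1) r' (tvps s1 x))#}, None))"
| "handle n i j (Response l r' t) s =
     (if rid s \<noteq> r' then (s, {#}, None) else
      let s1 = s\<lparr>lt := max (lt s) l + 1, responses := responses s \<union> {RespQ t j}\<rparr>
      in if card (responses s1) = n div 2 + 1 then
           (let tv = Max {u. \<exists>k. RespQ u k \<in> responses s1};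
                s2 = s1\<lparr>rval := snd tv, responses := {}, rid := rid s1 + 1\<rparr>
            in (s2, bcast n i (Update (lt s2) (rid s2) (rreg s2) tv), None))
         else (s1, {#}, None))"
| "handle n i j (Update l r' x t) s =
     (let s1 = s\<lparr>lt := max (lt s) l + 1, tvps := (tvps s)(x := max (tvps s x) t)\<rparr>
      in (s1, {#Msg i j (Ack (lt s1) r')#}, None))"
| "handle n i j (Ack l r') s =
     (if rid s \<noteq> r' then (s, {#}, None) else
      let s1 = s\<lparr>lt := max (lt s) l + 1, responses := responses s \<union> {RespA j}\<rparr>
      in if card (responses s1) = n div 2 + 1 then
           (let s2 = s1\<lparr>responses := {}, rid := rid s1 + 1, busy := False\<rparr>
            in (s2, {#}, Some (if reading s1 then RVal (rval s1) else ROK)))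
         else (s1, {#}, None))"

record cfg =
  ls :: "proc \<Rightarrow> lstate"
  crashed :: "proc set"
  net :: "msg multiset"

definition init_cfg :: cfg where
  "init_cfg = \<lparr>ls = (\<lambda>_. init_lstate), crashed = {}, net = {#}\<rparr>"

datatype label = Invoke proc op | Deliver msg | Crash proc | Skip

fun enabled :: "nat \<Rightarrow> nat \<Rightarrow> cfg \<Rightarrow> label \<Rightarrow> bool" where
  "enabled n f c (Invoke i o') = (i \<in> {1..n} \<and> i \<notin> crashed c \<and> \<not> busy (ls c i))"
| "enabled n f c (Deliver m) = (m \<in># net c \<and> dst m \<notin> crashed c)"
| "enabled n f c (Crash i) = (i \<in> {1..n} \<and> i \<notin> crashed c \<and> card (crashed c) < f)"
| "enabled n f c Skip = True"

fun exec_step :: "nat \<Rightarrow> cfg \<Rightarrow> label \<Rightarrow> cfg \<times> event list" where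
  "exec_step n c (Invoke i (Read x)) =
     (let s = ls c i; l = lt s + 1; r = rid s + 1;
          s' = s\<lparr>lt := l, reading := True, rreg := x, rid := r, busy := True\<rparr>
      in (c\<lparr>ls := (ls c)(i := s'), net := net c + bcast n i (Query l r x)\<rparr>, [Inv i (Read x)]))"
| "exec_step n c (Invoke i (Write x v)) =
     (let s = ls c i; l = lt s + 1; tv = ((l, i), v); r = rid s + 1;
          s' = s\<lparr>lt := l, reading := False, rid := r, busy := True\<rparr>
      in (c\<lparr>ls := (ls c)(i := s'), net := net c + bcast n i (Update l r x tv)\<rparr>, [Inv i (Write x v)]))"
| "exec_step n c (Deliver m) =
     (case handle n (dst m) (src m) (body m) (ls c (dst m)) of
        (s', out, res) \<Rightarrow>
          (c\<lparr>ls := (ls c)(dst m := s'), net := (net c - {#m#}) + out\<rparr>,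
           (case res of None \<Rightarrow> [] | Some v \<Rightarrow> [Res (dst m) v])))"
| "exec_step n c (Crash i) = (c\<lparr>crashed := insert i (crashed c)\<rparr>, [])"
| "exec_step n c Skip = (c, [])"

fun valid_run :: "nat \<Rightarrow> nat \<Rightarrow> cfg \<Rightarrow> label list \<Rightarrow> bool" where
  "valid_run n f c [] = True"
| "valid_run n f c (a # as) = (enabled n f c a \<and> valid_run n f (fst (exec_step n c a)) as)"

fun run_history :: "nat \<Rightarrow> cfg \<Rightarrow> label list \<Rightarrow> event list" where
  "run_history n c [] = []"
| "run_history n c (a # as) = snd (exec_step n c a) @ run_history n (fst (exec_step n c a)) as"

definition is_execution :: "nat \<Rightarrow> nat \<Rightarrow> (nat \<Rightarrow> cfg) \<Rightarrow> (nat \<Rightarrow> label) \<Rightarrow> bool" where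
  "is_execution n f C L \<longleftrightarrow> C 0 = init_cfg \<and>
     (\<forall>t. enabled n f (C t) (L t) \<and> C (Suc t) = fst (exec_step n (C t) (L t)))"

definition correct_proc :: "nat \<Rightarrow> (nat \<Rightarrow> cfg) \<Rightarrow> proc \<Rightarrow> bool" where
  "correct_proc n C i \<longleftrightarrow> i \<in> {1..n} \<and> (\<forall>t. i \<notin> crashed (C t))"

text \<open>Reliable links: every message in transit between correct processes is eventually delivered.\<close>
definition fair_execution :: "nat \<Rightarrow> (nat \<Rightarrow> cfg) \<Rightarrow> (nat \<Rightarrow> label) \<Rightarrow> bool" where
  "fair_execution n C L \<longleftrightarrow>
     (\<forall>t m. m \<in># net (C t) \<longrightarrow> correct_proc n C (src m) \<longrightarrow> correct_proc n C (dst m) \<longrightarrow>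
        (\<exists>t' \<ge> t. L t' = Deliver m))"

end

theory Submission
  imports Defs
begin

text \<open>
  Safety. Replace real time by the logical clock: say that an operation precedes another one if the
  clock (with the process id as tie-break) at its response is smaller than the clock at the
  invocation of the other. With respect to this order SC-ABD is linearizable: if an operation
  precedes a read of the same register, then some process lies in the majority that
  stored the timestamp of the former and in the majority queried by the latter, and since clocks
  increase along messages it stored the timestamp before it answered the query; if an operation
  precedes a write, then its timestamp is smaller because the write is stamped with its own
  invocation clock and every timestamp is smaller than the clock of whoever knows it. Logical
  precedence extends the program order of each process, so a linearization in logical time
  witnesses sequential consistency.

  Termination. As long as the request id of a correct process does not change, the replies of all
  correct processes are eventually collected; they are more than half of all processes, so
  the request id does change, which ends the query or the update phase.
\<close>

section \<open>Executions with auxiliary state\<close>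

datatype phase = Idle | Querying | Updating

record opr =
  agent :: proc
  act :: op
  ini :: nat
  fin :: nat
  stamp :: tsv

fun op_reg :: "op \<Rightarrow> reg" where
  "op_reg (Read x) = x"
| "op_reg (Write x v) = x"

fun is_read :: "op \<Rightarrow> bool" where
  "is_read (Read x) = True"
| "is_read (Write x v) = False"

text \<open>
  Arguments of \<open>reach n S N ph A G W D H\<close>: local states \<open>S\<close> and messages in transit \<open>N\<close>; the
  phase \<open>ph i\<close> and the latest operation \<open>A i\<close> of process \<open>i\<close> (its \<open>fin\<close> is set only when it completes,
  and the \<open>stamp\<close> of a read only when its query phase ends); \<open>G k l x\<close>, the entry for \<open>x\<close> that
  process \<open>k\<close> held at logical time \<open>l\<close>, which cannot change any more once the clock of \<open>k\<close> has
  reached \<open>l\<close> (for later \<open>l\<close> it is the current entry); the set \<open>W\<close> of all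
  register--entry pairs written so far; the completed operations \<open>D\<close>; the history \<open>H\<close>.
  Crashes are irrelevant for safety and leave no trace here.
\<close>
inductive reach :: "nat \<Rightarrow> (proc \<Rightarrow> lstate) \<Rightarrow> msg multiset \<Rightarrow> (proc \<Rightarrow> phase) \<Rightarrow> (proc \<Rightarrow> opr) \<Rightarrow>
    (proc \<Rightarrow> nat \<Rightarrow> reg \<Rightarrow> tsv) \<Rightarrow> (reg \<times> tsv) set \<Rightarrow> opr list \<Rightarrow> event list \<Rightarrow> bool"
  for n :: nat where
  init: "reach n (\<lambda>_. init_lstate) {#} (\<lambda>_. Idle) (\<lambda>_. undefined) (\<lambda>_ _ _. ((0, 0), 0))
           (UNIV \<times> {((0, 0), 0)}) [] []"
| invoke_read: "\<lbrakk>reach n S N ph A G W D H; i \<in> {1..n}; \<not> busy (S i); l' = lt (S i) + 1; r' = rid (S i) + 1\<rbrakk>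
    \<Longrightarrow> reach n (S(i := (S i)\<lparr>lt := l', reading := True, rreg := x, rid := r', busy := True\<rparr>))
          (N + bcast n i (Query l' r' x)) (ph(i := Querying))
          (A(i := \<lparr>agent = i, act = Read x, ini = l', fin = 0, stamp = ((0, 0), 0)\<rparr>)) G W D
          (H @ [Inv i (Read x)])"
| invoke_write: "\<lbrakk>reach n S N ph A G W D H; i \<in> {1..n}; \<not> busy (S i); l' = lt (S i) + 1; r' = rid (S i) + 1\<rbrakk>
    \<Longrightarrow> reach n (S(i := (S i)\<lparr>lt := l', reading := False, rid := r', busy := True\<rparr>))
          (N + bcast n i (Update l' r' x ((l', i), v))) (ph(i := Updating))
          (A(i := \<lparr>agent = i, act = Write x v, ini = l', fin = 0, stamp = ((l', i), v)\<rparr>)) G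
          (insert (x, ((l', i), v)) W) D (H @ [Inv i (Write x v)])"
| query: "\<lbrakk>reach n S N ph A G W D H; Msg j i (Query l r x) \<in># N; l' = max (lt (S i)) l + 1\<rbrakk>
    \<Longrightarrow> reach n (S(i := (S i)\<lparr>lt := l'\<rparr>))
          (N - {#Msg j i (Query l r x)#} + {#Msg i j (Response l' r (tvps (S i) x))#}) ph A G W D H"
| update: "\<lbrakk>reach n S N ph A G W D H; Msg j i (Update l r x u) \<in># N; l' = max (lt (S i)) l + 1;
      u' = max (tvps (S i) x) u\<rbrakk>
    \<Longrightarrow> reach n (S(i := (S i)\<lparr>lt := l', tvps := (tvps (S i))(x := u')\<rparr>))
          (N - {#Msg j i (Update l r x u)#} + {#Msg i j (Ack l' r)#}) ph A
          (G(i := (\<lambda>k y. if l' \<le> k \<and> y = x then u' else G i k y))) W D H"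
| stale: "\<lbrakk>reach n S N ph A G W D H; m \<in># N\<rbrakk> \<Longrightarrow> reach n S (N - {#m#}) ph A G W D H"
| response: "\<lbrakk>reach n S N ph A G W D H; Msg j i (Response l r u) \<in># N; rid (S i) = r;
      l' = max (lt (S i)) l + 1; R = insert (RespQ u j) (responses (S i)); card R \<noteq> n div 2 + 1\<rbrakk>
    \<Longrightarrow> reach n (S(i := (S i)\<lparr>lt := l', responses := R\<rparr>)) (N - {#Msg j i (Response l r u)#}) ph A G W D H"
| response_quorum: "\<lbrakk>reach n S N ph A G W D H; Msg j i (Response l r u) \<in># N; rid (S i) = r;
      l' = max (lt (S i)) l + 1; R = insert (RespQ u j) (responses (S i)); card R = n div 2 + 1;
      tv = Max {u. \<exists>k. RespQ u k \<in> R}; r' = r + 1\<rbrakk>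
    \<Longrightarrow> reach n (S(i := (S i)\<lparr>lt := l', rval := snd tv, responses := {}, rid := r'\<rparr>))
          (N - {#Msg j i (Response l r u)#} + bcast n i (Update l' r' (rreg (S i)) tv))
          (ph(i := Updating)) (A(i := (A i)\<lparr>stamp := tv\<rparr>)) G W D H"
| ack: "\<lbrakk>reach n S N ph A G W D H; Msg j i (Ack l r) \<in># N; rid (S i) = r;
      l' = max (lt (S i)) l + 1; R = insert (RespA j) (responses (S i)); card R \<noteq> n div 2 + 1\<rbrakk>
    \<Longrightarrow> reach n (S(i := (S i)\<lparr>lt := l', responses := R\<rparr>)) (N - {#Msg j i (Ack l r)#}) ph A G W D H"
| ack_quorum: "\<lbrakk>reach n S N ph A G W D H; Msg j i (Ack l r) \<in># N; rid (S i) = r;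
      l' = max (lt (S i)) l + 1; R = insert (RespA j) (responses (S i)); card R = n div 2 + 1\<rbrakk>
    \<Longrightarrow> reach n (S(i := (S i)\<lparr>lt := l', responses := {}, rid := r + 1, busy := False\<rparr>))
          (N - {#Msg j i (Ack l r)#}) (ph(i := Idle)) A G W (D @ [(A i)\<lparr>fin := l'\<rparr>])
          (H @ [Res i (if reading (S i) then RVal (rval (S i)) else ROK)])"

section \<open>Every run of the algorithm is tracked by an auxiliary execution\<close>

lemma reach_exec_step:
  assumes "reach n (ls c) (net c) ph A G W D H" "enabled n f c a"
  shows "\<exists>ph A G W D. reach n (ls (fst (exec_step n c a))) (net (fst (exec_step n c a))) ph A G W D
           (H @ snd (exec_step n c a))"
proof (cases a)
  case (Invoke i o')
  show ?thesis
  proof (cases o')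
    case (Read x)
    then show ?thesis
      using reach.invoke_read[OF assms(1) _ _ refl refl, of i x] assms(2) Invoke by (simp add: Let_def) blast
  next
    case (Write x v)
    then show ?thesis
      using reach.invoke_write[OF assms(1) _ _ refl refl, of i x v] assms(2) Invoke by (simp add: Let_def) blast
  qed
next
  case (Deliver m)
  obtain j i b where m: "m = Msg j i b" by (cases m)
  have mem: "Msg j i b \<in># net c" using assms(2) Deliver m by simp
  show ?thesis
  proof (cases b)
    case (Query l r x)
    show ?thesis
      using reach.query[OF assms(1) mem[unfolded Query] refl] Deliver m Query
      by (simp add: Let_def) blast
  next
    case (Update l r x u)
    show ?thesis
      using reach.update[OF assms(1) mem[unfolded Update] refl refl] Deliver m Update
      by (simp add: Let_def) blast
  next
    case (Response l r u)
    note mem = mem[unfolded Response]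
    let ?R = "insert (RespQ u j) (responses (ls c i))"
    consider "rid (ls c i) \<noteq> r" | "rid (ls c i) = r" "card ?R \<noteq> n div 2 + 1"
      | "rid (ls c i) = r" "card ?R = n div 2 + 1" by blast
    then show ?thesis
    proof cases
      \<comment> \<open>An outdated reply leaves the local state alone; \<open>stale\<close>, which
        may drop any message, covers it.\<close>
      case 1
      then show ?thesis using reach.stale[OF assms(1) mem] Deliver m Response by simp blast
    next
      case 2
      then show ?thesis
        using reach.response[OF assms(1) mem _ refl refl] Deliver m Response
        by (simp add: Let_def) blast
    next
      case 3
      then show ?thesis
        using reach.response_quorum[OF assms(1) mem _ refl refl _ refl refl] Deliver m Response
        by (simp add: Let_def) blast
    qed
  next
    case (Ack l r)
    note mem = mem[unfolded Ack]
    let ?R = "insert (RespA j) (responses (ls c i))"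
    consider "rid (ls c i) \<noteq> r" | "rid (ls c i) = r" "card ?R \<noteq> n div 2 + 1"
      | "rid (ls c i) = r" "card ?R = n div 2 + 1" by blast
    then show ?thesis
    proof cases
      case 1
      then show ?thesis using reach.stale[OF assms(1) mem] Deliver m Ack by simp blast
    next
      case 2
      then show ?thesis
        using reach.ack[OF assms(1) mem _ refl refl] Deliver m Ack by (simp add: Let_def) blast
    next
      case 3
      then show ?thesis
        using reach.ack_quorum[OF assms(1) mem _ refl refl] Deliver m Ack
        by (cases "reading (ls c i)"; simp add: Let_def; blast)
    qed
  qed
next
  case (Crash i)
  then show ?thesis using assms(1) by simp blast
next
  case Skip
  then show ?thesis using assms(1) by simp blast
qed

lemma reach_run:
  assumes "reach n (ls c) (net c) ph A G W D H" "valid_run n f c as"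
  shows "\<exists>S N ph A G W D. reach n S N ph A G W D (H @ run_history n c as)"
  using assms
proof (induction as arbitrary: c ph A G W D H)
  case Nil
  then show ?case by simp blast
next
  case (Cons a as)
  obtain ph' A' G' W' D' where
    "reach n (ls (fst (exec_step n c a))) (net (fst (exec_step n c a))) ph' A' G' W' D'
       (H @ snd (exec_step n c a))"
    using reach_exec_step[OF Cons.prems(1)] Cons.prems(2) by (metis valid_run.simps(2))
  from Cons.IH[OF this] Cons.prems(2) show ?case by simp
qed

section \<open>Request ids and collected responses\<close>

fun owner :: "msg \<Rightarrow> proc \<times> nat" where
  "owner (Msg i j (Query l r x)) = (i, r)"
| "owner (Msg i j (Update l r x u)) = (i, r)"
| "owner (Msg i j (Response l r u)) = (j, r)"
| "owner (Msg i j (Ack l r)) = (j, r)"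

text \<open>A request and the reply to it agree in \<open>owner\<close> and \<open>peer\<close>, so
  answering a request only changes the form of one token, identified by this pair.\<close>

fun peer :: "msg \<Rightarrow> proc" where
  "peer (Msg i j (Query l r x)) = j"
| "peer (Msg i j (Update l r x u)) = j"
| "peer (Msg i j (Response l r u)) = i"
| "peer (Msg i j (Ack l r)) = i"

fun sender :: "resp \<Rightarrow> proc" where
  "sender (RespQ u k) = k"
| "sender (RespA k) = k"

lemma in_bcast [simp]: "m \<in># bcast n i b \<longleftrightarrow> (\<exists>j\<in>{1..n}. m = Msg i j b)"
  unfolding bcast_def by auto

lemma reach_src_dst:
  "reach n S N ph A G W D H \<Longrightarrow> m \<in># N \<Longrightarrow> src m \<in> {1..n} \<and> dst m \<in> {1..n}"
proof (induction arbitrary: m rule: reach.induct)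
qed (fastforce dest: in_diffD)+

text \<open>Ids are taken from the increasing counter of the owner and copied into replies. Hence a
  freshly incremented counter is an id that no message in transit carries.\<close>

lemma reach_rid:
  "reach n S N ph A G W D H \<Longrightarrow> m \<in># N \<Longrightarrow> snd (owner m) \<le> rid (S (fst (owner m)))"
proof (induction arbitrary: m rule: reach.induct)
  case (invoke_read S N ph A G W D H i l' r' x)
  then show ?case by (fastforce intro: le_SucI)
next
  case (invoke_write S N ph A G W D H i l' r' x v)
  then show ?case by (fastforce intro: le_SucI)
next
  case (query S N ph A G W D H j i l r x l')
  then show ?case using query.IH[OF query.hyps(2)] by (auto dest!: in_diffD)
next
  case (update S N ph A G W D H j i l r x u l' u')
  then show ?case using update.IH[OF update.hyps(2)] by (auto dest!: in_diffD)
next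
  case (response_quorum S N ph A G W D H j i l r u l' R tv r')
  from response_quorum.prems have "m \<in># N \<or> (\<exists>k. m = Msg i k (Update l' r' (rreg (S i)) tv))"
    by (auto dest: in_diffD)
  then show ?case using response_quorum.IH[of m] response_quorum.hyps(3,8) by (auto intro: le_SucI)
next
  case (ack_quorum S N ph A G W D H j i l r l' R)
  then show ?case by (auto dest!: in_diffD intro!: le_SucI)
qed (auto dest!: in_diffD)

text \<open>The set grows by at most one element per step and is emptied as soon as it has
  \<open>n div 2 + 1\<close> elements, so the equality test for a quorum cannot be overshot.
  Termination contradicts this bound.\<close>

lemma reach_responses:
  "reach n S N ph A G W D H \<Longrightarrow> finite (responses (S i)) \<and> card (responses (S i)) \<le> n div 2 \<and>
     sender ` responses (S i) \<subseteq> {1..n}"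
proof (induction arbitrary: i rule: reach.induct)
  case (response S N ph A G W D H j k l r u l' R)
  have "j \<in> {1..n}" using reach_src_dst[OF response.hyps(1,2)] by simp
  moreover have "card R \<le> Suc (card (responses (S k)))" using response.hyps
    by (simp add: card_insert_if response.IH)
  ultimately show ?case using response.IH[of i] response.IH[of k] response.hyps by auto
next
  case (ack S N ph A G W D H j k l r l' R)
  have "j \<in> {1..n}" using reach_src_dst[OF ack.hyps(1,2)] by simp
  moreover have "card R \<le> Suc (card (responses (S k)))" using ack.hyps
    by (simp add: card_insert_if ack.IH)
  ultimately show ?case using ack.IH[of i] ack.IH[of k] ack.hyps by auto
qed (auto simp: init_lstate_def)

section \<open>Each process answers a request at most once\<close>

definition pending :: "msg multiset \<Rightarrow> proc \<Rightarrow> nat \<Rightarrow> proc \<Rightarrow> nat" where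
  "pending N i r k = size {#m \<in># N. owner m = (i, r) \<and> peer m = k#}"

lemma pending_empty [simp]: "pending {#} i r k = 0"
  by (simp add: pending_def)

lemma pending_add_mset [simp]:
  "pending (add_mset m N) i r k = pending N i r k + (if owner m = (i, r) \<and> peer m = k then 1 else 0)"
  by (simp add: pending_def)

lemma pending_plus [simp]: "pending (N + M) i r k = pending N i r k + pending M i r k"
  by (simp add: pending_def)

lemma pending_minus:
  "m \<in># N \<Longrightarrow> pending (N - {#m#}) i r k + (if owner m = (i, r) \<and> peer m = k then 1 else 0) = pending N i r k"
  by (metis insert_DiffM pending_add_mset)

lemma pending_bcast:
  assumes "\<And>j. owner (Msg i j b) = (i, r)" "\<And>j. peer (Msg i j b) = j"
  shows "pending (bcast n i b) i' r' k = (if i' = i \<and> r' = r \<and> k \<in> {1..n} then 1 else 0)"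
proof (induction n)
  case 0
  then show ?case by (simp add: pending_def bcast_def)
next
  case (Suc n)
  have "bcast (Suc n) i b = bcast n i b + {#Msg i (Suc n) b#}" by (simp add: bcast_def)
  then show ?case using Suc assms by auto
qed

lemma pending_fresh:
  assumes "reach n S N ph A G W D H" "rid (S i) < r"
  shows "pending N i r k = 0"
proof -
  have "\<not> (owner m = (i, r) \<and> peer m = k)" if "m \<in># N" for m
    using reach_rid[OF assms(1) that] assms(2) by auto
  then have "{#m \<in># N. owner m = (i, r) \<and> peer m = k#} = {#}" by (simp add: filter_mset_eq_mempty_iff)
  then show ?thesis by (simp only: pending_def size_empty)
qed

lemma pending_pos: "m \<in># N \<Longrightarrow> owner m = (i, r) \<Longrightarrow> peer m = k \<Longrightarrow> 0 < pending N i r k"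
  using pending_minus[of m N i r k] by simp

lemma pending_minus_le: "pending (N - {#m#}) i r k \<le> pending N i r k"
  unfolding pending_def by (intro size_mset_mono multiset_filter_mono diff_subset_eq_self)

lemma pending_reply:
  assumes "m \<in># N" "owner m' = owner m" "peer m' = peer m"
  shows "pending (N - {#m#} + {#m'#}) i r k = pending N i r k"
  using pending_minus[OF assms(1), of i r k] assms(2,3) by simp

text \<open>Responses to a query are pairs of an entry and a process, so a quorum of pairs is a
  quorum of processes only if nobody is counted twice. For each peer there is at most one token: a
  request in transit, then its reply, then an element of \<open>responses\<close>. Without an
  outstanding operation the current id has not been sent out.\<close>

definition token_inv where
  "token_inv S N i \<longleftrightarrow>
     (\<forall>k. pending N i (rid (S i)) k + card {e \<in> responses (S i). sender e = k} \<le> 1) \<and>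
     (\<not> busy (S i) \<longrightarrow> responses (S i) = {} \<and> (\<forall>k. pending N i (rid (S i)) k = 0))"

lemma token_inv_mono:
  assumes "token_inv S N i" "\<And>k. pending N' i (rid (S i)) k \<le> pending N i (rid (S i)) k"
    "busy (S' i) = busy (S i)" "rid (S' i) = rid (S i)" "responses (S' i) = responses (S i)"
  shows "token_inv S' N' i"
proof -
  have "pending N' i (rid (S i)) k + c \<le> 1" if "pending N i (rid (S i)) k + c \<le> 1" for k c
    using assms(2)[of k] that by linarith
  moreover have "pending N' i (rid (S i)) k = 0" if "pending N i (rid (S i)) k = 0" for k
    using assms(2)[of k] that by linarith
  ultimately show ?thesis using assms(1,3-5) unfolding token_inv_def by simp
qed

text \<open>The token of \<open>sender e\<close> moves from the network into
  \<open>responses\<close>, and the sum does not grow.\<close>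

lemma token_inv_collect:
  assumes "token_inv S N i" "m \<in># N" "owner m = (i, rid (S i))" "peer m = sender e"
    "finite (responses (S i))" "busy (S' i) = busy (S i)" "rid (S' i) = rid (S i)"
    "responses (S' i) = insert e (responses (S i))"
  shows "token_inv S' (N - {#m#}) i"
proof -
  have "pending (N - {#m#}) i (rid (S' i)) k + card {e \<in> responses (S' i). sender e = k} \<le> 1" for k
  proof -
    have "{e \<in> responses (S' i). sender e = k} = (if sender e = k then insert e {e \<in> responses (S i). sender e = k}
        else {e \<in> responses (S i). sender e = k})"
      using assms(8) by auto
    then have "card {e \<in> responses (S' i). sender e = k}
        \<le> card {e \<in> responses (S i). sender e = k} + (if sender e = k then 1 else 0)"
      using assms(5) by (simp add: card_insert_if)
    moreover have "pending (N - {#m#}) i (rid (S i)) k + (if sender e = k then 1 else 0) = pending N i (rid (S i)) k"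
      using pending_minus[OF assms(2), of i "rid (S i)" k] assms(3,4) by simp
    moreover have "pending N i (rid (S i)) k + card {e \<in> responses (S i). sender e = k} \<le> 1"
      using assms(1) by (simp add: token_inv_def)
    ultimately show ?thesis using assms(7) by simp
  qed
  \<comment> \<open>By the second clause of \<open>token_inv\<close>, an idle process has no message
    with its current id in transit.\<close>
  moreover have "busy (S i)"
    using assms(1) pending_pos[OF assms(2,3,4)] unfolding token_inv_def by force
  ultimately show ?thesis using assms(6) unfolding token_inv_def by blast
qed

text \<open>The new id exceeds all ids of \<open>i\<close> in \<open>N\<close>, so only the newly
  sent messages \<open>M\<close> can carry it.\<close>

lemma token_inv_fresh:
  assumes "reach n S N ph A G W D H" "rid (S i) < rid (S' i)"
    "N' \<subseteq># N" "\<And>k. pending M i (rid (S' i)) k \<le> (if busy (S' i) then 1 else 0)" "responses (S' i) = {}"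
  shows "token_inv S' (N' + M) i"
proof -
  have "pending N' i (rid (S' i)) k \<le> pending N i (rid (S' i)) k" for k
    unfolding pending_def using assms(3) by (intro size_mset_mono multiset_filter_mono)
  then have "pending N' i (rid (S' i)) k = 0" for k
    using pending_fresh[OF assms(1,2)] by simp
  moreover have "pending M i (rid (S' i)) k \<le> 1 \<and> (\<not> busy (S' i) \<longrightarrow> pending M i (rid (S' i)) k = 0)" for k
    using assms(4)[of k] by (simp split: if_splits)
  ultimately show ?thesis using assms(5) unfolding token_inv_def by simp
qed

lemma reach_token_inv: "reach n S N ph A G W D H \<Longrightarrow> token_inv S N i"
proof (induction arbitrary: i rule: reach.induct)
  case init
  then show ?case by (simp add: token_inv_def pending_def init_lstate_def)
next
  case (invoke_read S N ph A G W D H i' l' r' x i)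
  have p: "pending (bcast n i' (Query l' r' x)) j q k =
      (if j = i' \<and> q = r' \<and> k \<in> {1..n} then 1 else 0)" for j q k
    by (rule pending_bcast) auto
  have "responses (S i') = {}"
    using invoke_read.hyps(3) invoke_read.IH[of i'] by (simp add: token_inv_def)
  show ?case
  proof (cases "i = i'")
    case True
    then show ?thesis
      using p invoke_read.hyps \<open>responses (S i') = {}\<close>
      by (intro token_inv_fresh[OF invoke_read.hyps(1), where i = i]) (simp_all add: True)
  next
    case False
    then show ?thesis using p by (intro token_inv_mono[OF invoke_read.IH]) simp_all
  qed
next
  case (invoke_write S N ph A G W D H i' l' r' x v i)
  have p: "pending (bcast n i' (Update l' r' x ((l', i'), v))) j q k =
      (if j = i' \<and> q = r' \<and> k \<in> {1..n} then 1 else 0)" for j q k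
    by (rule pending_bcast) auto
  have "responses (S i') = {}"
    using invoke_write.hyps(3) invoke_write.IH[of i'] by (simp add: token_inv_def)
  show ?case
  proof (cases "i = i'")
    case True
    then show ?thesis
      using p invoke_write.hyps \<open>responses (S i') = {}\<close>
      by (intro token_inv_fresh[OF invoke_write.hyps(1), where i = i]) (simp_all add: True)
  next
    case False
    then show ?thesis using p by (intro token_inv_mono[OF invoke_write.IH]) simp_all
  qed
next
  case (query S N ph A G W D H j i' l r x l' i)
  show ?case
    by (rule token_inv_mono[OF query.IH])
      (use pending_reply[OF query.hyps(2), of "Msg i' j (Response l' r (tvps (S i') x))"] in auto)
next
  case (update S N ph A G W D H j i' l r x u l' u' i)
  show ?case
    by (rule token_inv_mono[OF update.IH])
      (use pending_reply[OF update.hyps(2), of "Msg i' j (Ack l' r)"] in auto)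
next
  case (stale S N ph A G W D H m i)
  show ?case by (rule token_inv_mono[OF stale.IH]) (simp_all add: pending_minus_le)
next
  case (response S N ph A G W D H j i' l r u l' R i)
  show ?case
  proof (cases "i = i'")
    case True
    then show ?thesis
      using response.hyps reach_responses[OF response.hyps(1)]
      by (intro token_inv_collect[OF response.IH response.hyps(2), where e = "RespQ u j"]) simp_all
  next
    case False
    then show ?thesis by (intro token_inv_mono[OF response.IH]) (simp_all add: pending_minus_le)
  qed
next
  case (response_quorum S N ph A G W D H j i' l r u l' R tv r' i)
  have p: "pending (bcast n i' (Update l' r' (rreg (S i')) tv)) j q k =
      (if j = i' \<and> q = r' \<and> k \<in> {1..n} then 1 else 0)" for j q k
    by (rule pending_bcast) auto
  show ?case
  proof (cases "i = i'")
    case True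
    have "busy (S i')"
      using response_quorum.IH[of i'] pending_pos[OF response_quorum.hyps(2), of i' r j] response_quorum.hyps(3)
      unfolding token_inv_def by force
    then show ?thesis
      using True p response_quorum.hyps
      by (intro token_inv_fresh[OF response_quorum.hyps(1), where i = i]) (simp_all add: True)
  next
    case False
    then show ?thesis using p by (intro token_inv_mono[OF response_quorum.IH]) (simp_all add: pending_minus_le)
  qed
next
  case (ack S N ph A G W D H j i' l r l' R i)
  show ?case
  proof (cases "i = i'")
    case True
    then show ?thesis
      using ack.hyps reach_responses[OF ack.hyps(1)]
      by (intro token_inv_collect[OF ack.IH ack.hyps(2), where e = "RespA j"]) simp_all
  next
    case False
    then show ?thesis by (intro token_inv_mono[OF ack.IH]) (simp_all add: pending_minus_le)
  qed
next
  case (ack_quorum S N ph A G W D H j i' l r l' R i)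
  show ?case
  proof (cases "i = i'")
    case True
    have "token_inv (S(i' := (S i')\<lparr>lt := l', responses := {}, rid := r + 1, busy := False\<rparr>))
        (N - {#Msg j i' (Ack l r)#} + {#}) i"
      using True ack_quorum.hyps
      by (intro token_inv_fresh[OF ack_quorum.hyps(1)]) simp_all
    then show ?thesis by (simp only: add_0_right)
  next
    case False
    then show ?thesis by (intro token_inv_mono[OF ack_quorum.IH]) (simp_all add: pending_minus_le)
  qed
qed

section \<open>Register entries as a function of logical time\<close>

lemma reach_G_tvps:
  "reach n S N ph A G W D H \<Longrightarrow> lt (S k) \<le> l \<Longrightarrow> G k l x = tvps (S k) x"
proof (induction arbitrary: k l x rule: reach.induct)
qed (auto simp: init_lstate_def split: if_splits)

lemma reach_G_mono:
  "reach n S N ph A G W D H \<Longrightarrow> l \<le> l' \<Longrightarrow> G k l x \<le> G k l' x"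
proof (induction arbitrary: k l l' x rule: reach.induct)
  case (update S N ph A G W D H j i m r y u m' u')
  \<comment> \<open>Pass to a time not before the clock of \<open>i\<close>, where \<open>G\<close>
    is the current entry; the update can only raise that entry.\<close>
  have "G i l y \<le> G i (max l (lt (S i))) y" using update.IH by simp
  also have "\<dots> = tvps (S i) y" using reach_G_tvps[OF update.hyps(1)] by simp
  also have "\<dots> \<le> u'" using update.hyps by simp
  finally show ?case using update.IH update.prems by auto
qed auto

section \<open>Invariants of the phases\<close>

text \<open>The monotonicity under which all facts about past operations are stable.\<close>
definition extends where
  "extends S G W S' G' W' \<longleftrightarrow> (\<forall>k. lt (S k) \<le> lt (S' k)) \<and> W \<subseteq> W' \<and>
     (\<forall>k l x. G k l x \<le> (G' k l x :: tsv)) \<and> (\<forall>k l x. l \<le> lt (S k) \<longrightarrow> G' k l x = G k l x)"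

definition majority :: "nat \<Rightarrow> proc set \<Rightarrow> bool" where
  "majority n Q \<longleftrightarrow> Q \<subseteq> {1..n} \<and> card Q = n div 2 + 1"

text \<open>The clause \<open>ini d \<le> lt (S k)\<close> freezes the entry of \<open>k\<close> at
  time \<open>ini d\<close>, so that its upper bound \<open>u\<close> survives later updates; the
  query carries \<open>ini d\<close> and pushes the clock of the responder past it. The last
  argument is a clock value of whoever knows \<open>u\<close>.\<close>

definition answer where
  "answer S G W d k u l \<longleftrightarrow> ini d \<le> lt (S k) \<and> G k (ini d) (op_reg (act d)) \<le> u \<and>
     (op_reg (act d), u :: tsv) \<in> W \<and> fst (fst u) \<le> l"

definition stored where
  "stored G d k l \<longleftrightarrow> stamp d \<le> G k l (op_reg (act d))"

definition read_quorum where
  "read_quorum n S G d \<longleftrightarrow>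
     (\<exists>Q. majority n Q \<and> (\<forall>k\<in>Q. ini d \<le> lt (S k) \<and> G k (ini d) (op_reg (act d)) \<le> stamp d))"

text \<open>Facts guarded by the current id concern the running phase of the owner and become
  vacuous once that phase ends. The first facts on an update carry no guard, since its receiver
  installs the entry whatever the id.\<close>

fun msg_inv where
  "msg_inv S ph A G W (Msg j i (Query l r x)) =
     (r = rid (S j) \<longrightarrow> ph j = Querying \<and> act (A j) = Read x \<and> l = ini (A j))"
| "msg_inv S ph A G W (Msg j i (Response l r u)) =
     (r = rid (S i) \<longrightarrow> ph i = Querying \<and> answer S G W (A i) j u l)"
| "msg_inv S ph A G W (Msg j i (Update l r x u)) =
     ((x, u) \<in> W \<and> fst (fst u) \<le> l \<and>
      (r = rid (S j) \<longrightarrow> ph j = Updating \<and> op_reg (act (A j)) = x \<and> stamp (A j) = u))"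
| "msg_inv S ph A G W (Msg j i (Ack l r)) =
     (r = rid (S i) \<longrightarrow> ph i = Updating \<and> stored G (A i) j l)"

definition op_inv where
  "op_inv n S G W d \<longleftrightarrow> agent d \<in> {1..n} \<and> (is_read (act d) \<longrightarrow> read_quorum n S G d) \<and>
     (\<forall>x v. act d = Write x v \<longrightarrow> stamp d = ((ini d, agent d), v)) \<and> (op_reg (act d), stamp d) \<in> W"

definition proc_inv where
  "proc_inv n S ph A G W i \<longleftrightarrow> (case ph i of
     Idle \<Rightarrow> \<not> busy (S i) \<and> responses (S i) = {}
   | Querying \<Rightarrow> busy (S i) \<and> reading (S i) \<and> act (A i) = Read (rreg (S i)) \<and> agent (A i) = i \<and> i \<in> {1..n} \<and>
       ini (A i) \<le> lt (S i) \<and>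
       (\<forall>e\<in>responses (S i). \<exists>u k. e = RespQ u k \<and> answer S G W (A i) k u (lt (S i)))
   | Updating \<Rightarrow> busy (S i) \<and> reading (S i) = is_read (act (A i)) \<and> (reading (S i) \<longrightarrow> rval (S i) = snd (stamp (A i))) \<and>
       agent (A i) = i \<and> op_inv n S G W (A i) \<and> fst (fst (stamp (A i))) \<le> lt (S i) \<and> ini (A i) \<le> lt (S i) \<and>
       (\<forall>e\<in>responses (S i). \<exists>k. e = RespA k \<and> stored G (A i) k (lt (S i))))"

definition done_inv where
  "done_inv n S G W d \<longleftrightarrow> op_inv n S G W d \<and> ini d < fin d \<and> fin d \<le> lt (S (agent d)) \<and>
     fst (fst (stamp d)) < fin d \<and> (\<exists>Q. majority n Q \<and> (\<forall>k\<in>Q. stored G d k (fin d)))"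

section \<open>Stability of facts about the past\<close>

lemma answer_extends:
  "extends S G W S' G' W' \<Longrightarrow> answer S G W d k u l \<Longrightarrow> l \<le> l' \<Longrightarrow> answer S' G' W' d k u l'"
  unfolding extends_def answer_def by (metis order_trans subset_iff)

lemma stored_extends:
  "extends S G W S' G' W' \<Longrightarrow> stored G d k l \<Longrightarrow> stored G' d k l"
  unfolding extends_def stored_def by (meson order_trans)

lemma read_quorum_extends:
  "extends S G W S' G' W' \<Longrightarrow> read_quorum n S G d \<Longrightarrow> read_quorum n S' G' d"
  unfolding extends_def read_quorum_def by (metis order_trans)

lemma op_inv_extends:
  "extends S G W S' G' W' \<Longrightarrow> op_inv n S G W d \<Longrightarrow> op_inv n S' G' W' d"
  using read_quorum_extends unfolding op_inv_def extends_def by blast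

lemma done_inv_extends:
  "extends S G W S' G' W' \<Longrightarrow> done_inv n S G W d \<Longrightarrow> done_inv n S' G' W' d"
  unfolding done_inv_def
  by (meson op_inv_extends stored_extends extends_def order_trans)

lemma msg_inv_extends:
  assumes "extends S G W S' G' W'" "msg_inv S ph A G W m" "i = fst (owner m)"
    "snd (owner m) = rid (S' i) \<Longrightarrow> rid (S' i) = rid (S i) \<and> ph' i = ph i \<and> A' i = A i"
  shows "msg_inv S' ph' A' G' W' m"
  using assms
  by (cases m rule: owner.cases)
    (auto intro: answer_extends stored_extends simp: extends_def)

lemma proc_inv_extends:
  assumes "extends S G W S' G' W'" "proc_inv n S ph A G W i"
    "busy (S' i) = busy (S i)" "responses (S' i) = responses (S i)" "reading (S' i) = reading (S i)"
    "rreg (S' i) = rreg (S i)" "rval (S' i) = rval (S i)" "ph' i = ph i" "A' i = A i"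
    "\<And>k x l l'. l \<le> l' \<Longrightarrow> G' k l x \<le> G' k l' x"
  shows "proc_inv n S' ph' A' G' W' i"
proof -
  have lt: "lt (S i) \<le> lt (S' i)" using assms(1) by (simp add: extends_def)
  have 1: "stored G' d k (lt (S' i))" if "stored G d k (lt (S i))" for d k
    using stored_extends[OF assms(1) that] assms(10)[OF lt] unfolding stored_def by (meson order_trans)
  show ?thesis
    using assms(2-9) lt answer_extends[OF assms(1) _ lt] op_inv_extends[OF assms(1)] 1
    unfolding proc_inv_def by (cases "ph i") (fastforce intro: order_trans)+
qed

lemma extends_same_G:
  "(\<And>k. lt (S k) \<le> lt (S' k)) \<Longrightarrow> W \<subseteq> W' \<Longrightarrow> extends S G W S' G W'"
  by (simp add: extends_def)

definition state_inv where
  "state_inv n S N ph A G W D \<longleftrightarrow>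
     (\<forall>i x. (x, tvps (S i) x) \<in> W \<and> fst (fst (tvps (S i) x)) \<le> lt (S i)) \<and>
     (\<forall>m\<in>#N. msg_inv S ph A G W m) \<and> (\<forall>i. proc_inv n S ph A G W i) \<and> (\<forall>d\<in>set D. done_inv n S G W d)"

text \<open>Frame rule for a step of process \<open>i\<close>: old facts are transferred along
  \<open>extends\<close>, which leaves the new messages, process \<open>i\<close> itself and newly
  completed operations. An old message matters only if it carries the new current id of
  \<open>i\<close>.\<close>

lemma state_inv_step:
  assumes IH: "state_inv n S N ph A G W D" and E: "extends S G W S' G' W'"
    and mono: "\<And>k x l l'. l \<le> l' \<Longrightarrow> G' k l x \<le> G' k l' x"
    and frame: "\<And>k. k \<noteq> i \<Longrightarrow> S' k = S k \<and> ph' k = ph k \<and> A' k = A k"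
    and tvps: "\<And>x. (x, tvps (S' i) x) \<in> W' \<and> fst (fst (tvps (S' i) x)) \<le> lt (S' i)"
    and msgs: "\<And>m. m \<in># N' \<Longrightarrow>
      m \<in># N \<and> (owner m = (i, rid (S' i)) \<longrightarrow> rid (S' i) = rid (S i) \<and> ph' i = ph i \<and> A' i = A i) \<or>
      msg_inv S' ph' A' G' W' m"
    and proc: "proc_inv n S' ph' A' G' W' i"
    and dones: "\<And>d. d \<in> set D' \<Longrightarrow> d \<in> set D \<or> done_inv n S' G' W' d"
  shows "state_inv n S' N' ph' A' G' W' D'"
  unfolding state_inv_def
proof (intro conjI ballI allI)
  fix k x
  have "(x, tvps (S' k) x) \<in> W' \<and> fst (fst (tvps (S' k) x)) \<le> lt (S' k)"
    using tvps frame[of k] IH E unfolding state_inv_def extends_def by (cases "k = i") auto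
  then show "(x, tvps (S' k) x) \<in> W'" "fst (fst (tvps (S' k) x)) \<le> lt (S' k)" by auto
next
  fix m assume "m \<in># N'"
  from msgs[OF this] show "msg_inv S' ph' A' G' W' m"
  proof
    assume *: "m \<in># N \<and> (owner m = (i, rid (S' i)) \<longrightarrow> rid (S' i) = rid (S i) \<and> ph' i = ph i \<and> A' i = A i)"
    then have "msg_inv S ph A G W m" using IH by (simp add: state_inv_def)
    then show ?thesis
    proof (rule msg_inv_extends[OF E _ refl])
      assume "snd (owner m) = rid (S' (fst (owner m)))"
      then show "rid (S' (fst (owner m))) = rid (S (fst (owner m))) \<and> ph' (fst (owner m)) = ph (fst (owner m)) \<and>
          A' (fst (owner m)) = A (fst (owner m))"
        using * frame by (metis prod.collapse)
    qed
  qed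
next
  fix k
  show "proc_inv n S' ph' A' G' W' k"
  proof (cases "k = i")
    case False
    then show ?thesis
      using frame[OF False] IH mono by (intro proc_inv_extends[OF E]) (simp_all add: state_inv_def)
  qed (use proc in simp)
next
  fix d assume "d \<in> set D'"
  then show "done_inv n S' G' W' d"
    using dones IH done_inv_extends[OF E] unfolding state_inv_def by blast
qed

text \<open>The reply being delivered still holds the token of its sender, so that sender has not
  been counted yet; tokens also make \<open>sender\<close> injective on the earlier responses. Hence
  there are as many responders as responses.\<close>

lemma reach_majority:
  assumes R: "reach n S N ph A G W D H" and m: "m \<in># N" "owner m = (i, rid (S i))" "peer m = sender e"
    and c: "card (insert e (responses (S i))) = n div 2 + 1"
  shows "majority n (sender ` insert e (responses (S i)))"
proof -
  let ?R = "insert e (responses (S i))"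
  note resp = reach_responses[OF R, of i]
  have tok: "pending N i (rid (S i)) k + card {e \<in> responses (S i). sender e = k} \<le> 1" for k
    using reach_token_inv[OF R, of i] by (simp add: token_inv_def)
  have "peer m \<in> {src m, dst m}" by (cases m rule: peer.cases) auto
  then have "sender e \<in> {1..n}" using reach_src_dst[OF R m(1)] m(3) by auto
  then have "sender ` ?R \<subseteq> {1..n}" using resp by auto
  moreover have "inj_on sender ?R"
  proof -
    have "0 < pending N i (rid (S i)) (sender e)" using pending_pos[OF m(1,2)] m(3) by simp
    then have "card {e' \<in> responses (S i). sender e' = sender e} = 0" using tok[of "sender e"] by linarith
    then have "{e' \<in> responses (S i). sender e' = sender e} = {}" using resp by simp
    moreover have "inj_on sender (responses (S i))"
    proof (rule inj_onI)
      fix a b assume ab: "a \<in> responses (S i)" "b \<in> responses (S i)" "sender a = sender b"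
      have "card {e \<in> responses (S i). sender e = sender a} \<le> Suc 0" using tok[of "sender a"] by linarith
      then show "a = b" using ab resp by (subst (asm) card_le_Suc0_iff_eq) auto
    qed
    ultimately show ?thesis by (auto simp: inj_on_insert)
  qed
  ultimately show ?thesis using c card_image unfolding majority_def by metis
qed

section \<open>Preservation of the invariants\<close>

lemma reach_state_inv: "reach n S N ph A G W D H \<Longrightarrow> state_inv n S N ph A G W D"
proof (induction rule: reach.induct)
  case init
  then show ?case by (simp add: state_inv_def init_lstate_def proc_inv_def)
next
  case (invoke_read S N ph A G W D H i l' r' x)
  note R = invoke_read.hyps(1) and IH = invoke_read.IH
  have "responses (S i) = {}" using reach_token_inv[OF R, of i] invoke_read.hyps(3) by (simp add: token_inv_def)
  moreover have "owner m \<noteq> (i, r')" if "m \<in># N" for m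
    using reach_rid[OF R that] invoke_read.hyps by auto
  ultimately show ?case using IH invoke_read.hyps
    by (intro state_inv_step[where i = i, OF IH extends_same_G reach_G_mono[OF R]])
      (auto simp: state_inv_def proc_inv_def intro: le_SucI)
next
  case (invoke_write S N ph A G W D H i l' r' x v)
  note R = invoke_write.hyps(1) and IH = invoke_write.IH
  have "responses (S i) = {}" using reach_token_inv[OF R, of i] invoke_write.hyps(3) by (simp add: token_inv_def)
  moreover have "owner m \<noteq> (i, r')" if "m \<in># N" for m
    using reach_rid[OF R that] invoke_write.hyps by auto
  ultimately show ?case using IH invoke_write.hyps
    by (intro state_inv_step[where i = i, OF IH extends_same_G reach_G_mono[OF R]])
      (auto simp: state_inv_def proc_inv_def op_inv_def intro: le_SucI)
next
  case (query S N ph A G W D H j i l r x l')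
  note R = query.hyps(1) and IH = query.IH
  let ?S = "S(i := (S i)\<lparr>lt := l'\<rparr>)"
  have E: "extends S G W ?S G W" using query.hyps(3) by (intro extends_same_G) auto
  have q: "r = rid (S j) \<longrightarrow> ph j = Querying \<and> act (A j) = Read x \<and> l = ini (A j)"
    using IH query.hyps(2) by (fastforce simp: state_inv_def)
  have tv: "(x, tvps (S i) x) \<in> W \<and> fst (fst (tvps (S i) x)) \<le> lt (S i)" for x
    using IH by (simp add: state_inv_def)
  \<comment> \<open>The time \<open>l\<close> of the query may lie beyond the clock of
    \<open>i\<close>, hence the detour over the maximum. The new clock \<open>l'\<close> exceeds
    \<open>l\<close> and freezes this bound.\<close>
  have "G i l x \<le> tvps (S i) x"
    using reach_G_mono[OF R, of l "max l (lt (S i))" i x] reach_G_tvps[OF R, of i "max l (lt (S i))" x] by simp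
  then have m: "msg_inv ?S ph A G W (Msg i j (Response l' r (tvps (S i) x)))"
    using q tv[of x] query.hyps(3) by (auto simp: answer_def)
  show ?case
  proof (rule state_inv_step[where i = i, OF IH E reach_G_mono[OF R]])
    show "proc_inv n ?S ph A G W i"
      using IH reach_G_mono[OF R] by (intro proc_inv_extends[OF E]) (simp_all add: state_inv_def)
    show "(y, tvps (?S i) y) \<in> W \<and> fst (fst (tvps (?S i) y)) \<le> lt (?S i)" for y
      using tv[of y] query.hyps(3) by auto
  qed (use m in \<open>auto dest: in_diffD\<close>)
next
  case (update S N ph A G W D H j i l r x u l' u')
  note R = update.hyps(1) and IH = update.IH
  note R' = reach.update[OF update.hyps]
  let ?S = "S(i := (S i)\<lparr>lt := l', tvps := (tvps (S i))(x := u')\<rparr>)"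
  let ?G = "G(i := (\<lambda>k y. if l' \<le> k \<and> y = x then u' else G i k y))"
  \<comment> \<open>At the rewritten times, all beyond the old clock, \<open>G\<close> holds the
    current entry, which the maximum \<open>u'\<close> does not lower; earlier times keep their
    entry.\<close>
  have "G i k x \<le> u'" if "l' \<le> k" for k
    using reach_G_tvps[OF R, of i k x] that update.hyps(3,4) by simp
  then have E: "extends S G W ?S ?G W" using update.hyps(3) by (auto simp: extends_def)
  have q: "(x, u) \<in> W \<and> fst (fst u) \<le> l \<and>
      (r = rid (S j) \<longrightarrow> ph j = Updating \<and> op_reg (act (A j)) = x \<and> stamp (A j) = u)"
    using IH update.hyps(2) by (fastforce simp: state_inv_def)
  have tv: "(x, tvps (S i) x) \<in> W \<and> fst (fst (tvps (S i) x)) \<le> lt (S i)" for x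
    using IH by (simp add: state_inv_def)
  have tv': "(y, tvps (?S i) y) \<in> W \<and> fst (fst (tvps (?S i) y)) \<le> lt (?S i)" for y
    using tv[of y] q update.hyps(3,4) by (auto simp: max_def intro: le_SucI)
  \<comment> \<open>The ack carries \<open>l'\<close>, the time from which on \<open>i\<close> holds
    at least \<open>u\<close>.\<close>
  have m: "msg_inv ?S ph A ?G W (Msg i j (Ack l' r))"
    using q update.hyps(4) by (auto simp: stored_def)
  show ?case
  proof (rule state_inv_step[where i = i, OF IH E reach_G_mono[OF R']])
    show "proc_inv n ?S ph A ?G W i"
      using IH reach_G_mono[OF R'] by (intro proc_inv_extends[OF E]) (simp_all add: state_inv_def)
  qed (use m tv' in \<open>auto simp: fun_upd_def dest: in_diffD\<close>)
next
  case (stale S N ph A G W D H m)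
  then show ?case by (auto simp: state_inv_def dest: in_diffD)
next
  case (response S N ph A G W D H j i l r u l' R)
  note Re = response.hyps(1) and IH = response.IH
  let ?S = "S(i := (S i)\<lparr>lt := l', responses := R\<rparr>)"
  have E: "extends S G W ?S G W" using response.hyps(4) by (intro extends_same_G) auto
  have q: "ph i = Querying" "answer S G W (A i) j u l"
    using IH response.hyps(2,3) by (fastforce simp: state_inv_def)+
  have p: "proc_inv n S ph A G W i" using IH by (simp add: state_inv_def)
  have lts: "l \<le> l'" "lt (S i) \<le> l'" using response.hyps(4) by auto
  have "\<exists>u k. e = RespQ u k \<and> answer ?S G W (A i) k u l'" if "e \<in> R" for e
  proof (cases "e \<in> responses (S i)")
    case True
    moreover have "\<forall>e\<in>responses (S i). \<exists>u k. e = RespQ u k \<and> answer S G W (A i) k u (lt (S i))"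
      using p q(1) by (simp add: proc_inv_def del: split_paired_Ex)
    ultimately show ?thesis using answer_extends[OF E _ lts(2)] by blast
  next
    case False
    then show ?thesis using that q(2) answer_extends[OF E _ lts(1)] response.hyps(5) by blast
  qed
  then have proc: "proc_inv n ?S ph A G W i"
    using p q lts unfolding proc_inv_def by auto
  show ?case
  proof (rule state_inv_step[where i = i, OF IH E reach_G_mono[OF Re]])
    show "(x, tvps (?S i) x) \<in> W \<and> fst (fst (tvps (?S i) x)) \<le> lt (?S i)" for x
      using IH lts(2) unfolding state_inv_def by (auto intro: le_trans)
  qed (use proc in \<open>auto dest: in_diffD\<close>)
next
  case (response_quorum S N ph A G W D H j i l r u l' R tv r')
  note Re = response_quorum.hyps(1) and IH = response_quorum.IH
  let ?S = "S(i := (S i)\<lparr>lt := l', rval := snd tv, responses := {}, rid := r'\<rparr>)"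
  let ?A = "A(i := (A i)\<lparr>stamp := tv\<rparr>)" and ?ph = "ph(i := Updating)"
  have E: "extends S G W ?S G W" using response_quorum.hyps(4) by (intro extends_same_G) auto
  have q: "ph i = Querying" "answer S G W (A i) j u l"
    using IH response_quorum.hyps(2,3) by (fastforce simp: state_inv_def)+
  have p: "proc_inv n S ph A G W i" using IH by (simp add: state_inv_def)
  have lts: "l \<le> l'" "lt (S i) \<le> l'" using response_quorum.hyps(4) by auto
  have ans: "\<exists>u k. e = RespQ u k \<and> answer ?S G W (A i) k u l'" if "e \<in> R" for e
  proof (cases "e \<in> responses (S i)")
    case True
    moreover have "\<forall>e\<in>responses (S i). \<exists>u k. e = RespQ u k \<and> answer S G W (A i) k u (lt (S i))"
      using p q(1) by (simp add: proc_inv_def del: split_paired_Ex)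
    ultimately show ?thesis using answer_extends[OF E _ lts(2)] by blast
  next
    case False
    then show ?thesis using that q(2) answer_extends[OF E _ lts(1)] response_quorum.hyps(5) by blast
  qed
  have "majority n (sender ` R)"
    using reach_majority[OF Re response_quorum.hyps(2), of i "RespQ u j"] response_quorum.hyps(3,5,6) by simp
  have ans': "answer ?S G W (A i) k u l'" if "RespQ u k \<in> R" for u k
    using ans[OF that] by (simp del: split_paired_Ex)
  let ?U = "{u. \<exists>k. RespQ u k \<in> R}"
  \<comment> \<open>By \<open>ans\<close> all elements of \<open>R\<close> have the form
    \<open>RespQ\<close>, so the missing case is never met.\<close>
  have "?U = (\<lambda>e. case e of RespQ u k \<Rightarrow> u) ` R"
    using ans by (force simp: image_iff split: resp.splits)
  then have fin: "finite ?U" using reach_responses[OF Re, of i] response_quorum.hyps(5) by simp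
  moreover have "u \<in> ?U" using response_quorum.hyps(5) by blast
  ultimately have "tv \<in> ?U" using Max_in response_quorum.hyps(7) by blast
  then have tv: "(op_reg (act (A i)), tv) \<in> W" "fst (fst tv) \<le> l'"
    using ans' unfolding answer_def by blast+
  \<comment> \<open>Each answer bounds the entry of its sender at time \<open>ini\<close>, and
    \<open>tv\<close> is the largest answer.\<close>
  have rq: "read_quorum n ?S G (?A i)"
    unfolding read_quorum_def
  proof (intro exI conjI ballI)
    fix k assume "k \<in> sender ` R"
    then obtain e where e: "e \<in> R" "sender e = k" by blast
    then obtain u where u: "RespQ u k \<in> R" using ans[OF e(1)] by (metis sender.simps(1))
    note u = u ans'[OF u]
    then have "u \<le> tv" using Max_ge[OF fin] response_quorum.hyps(7) by blast
    then show "ini (?A i) \<le> lt (?S k)" "G k (ini (?A i)) (op_reg (act (?A i))) \<le> stamp (?A i)"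
      using u(2) by (auto simp: answer_def)
  qed fact
  have act: "act (A i) = Read (rreg (S i))" using p q by (simp add: proc_inv_def)
  have "proc_inv n ?S ?ph ?A G W i"
    using p q(1) rq tv lts act unfolding proc_inv_def op_inv_def by auto
  note proc = this
  let ?m = "\<lambda>k. Msg i k (Update l' r' (rreg (S i)) tv)"
  have fresh: "owner m \<noteq> (i, r')" if "m \<in># N" for m
    using reach_rid[OF Re that] response_quorum.hyps(3,8) by auto
  have upd: "msg_inv ?S ?ph ?A G W (?m k)" for k
    using tv act by simp
  show ?case
  proof (rule state_inv_step[where i = i, OF IH E reach_G_mono[OF Re]])
    fix m assume "m \<in># N - {#Msg j i (Response l r u)#} + bcast n i (Update l' r' (rreg (S i)) tv)"
    then consider "m \<in># N" | k where "m = ?m k" by (auto dest: in_diffD)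
    then show "m \<in># N \<and> (owner m = (i, rid (?S i)) \<longrightarrow> rid (?S i) = rid (S i) \<and> ?ph i = ph i \<and> ?A i = A i) \<or>
        msg_inv ?S ?ph ?A G W m"
      by cases (use fresh upd in \<open>simp_all del: msg_inv.simps\<close>)
  next
    show "(x, tvps (?S i) x) \<in> W \<and> fst (fst (tvps (?S i) x)) \<le> lt (?S i)" for x
      using IH lts(2) unfolding state_inv_def by (auto intro: le_trans)
    show "proc_inv n ?S ?ph ?A G W i" by (fact proc)
  qed simp_all
next
  case (ack S N ph A G W D H j i l r l' R)
  note Re = ack.hyps(1) and IH = ack.IH
  let ?S = "S(i := (S i)\<lparr>lt := l', responses := R\<rparr>)"
  have E: "extends S G W ?S G W" using ack.hyps(4) by (intro extends_same_G) auto
  have q: "ph i = Updating" "stored G (A i) j l"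
    using IH ack.hyps(2,3) by (fastforce simp: state_inv_def)+
  have p: "proc_inv n S ph A G W i" using IH by (simp add: state_inv_def)
  have lts: "l \<le> l'" "lt (S i) \<le> l'" using ack.hyps(4) by auto
  have mono: "stored G d k l'" if "stored G d k l''" "l'' \<le> l'" for d k l''
    using that reach_G_mono[OF Re] unfolding stored_def by (meson order_trans)
  have "\<exists>k. e = RespA k \<and> stored G (A i) k l'" if "e \<in> R" for e
  proof (cases "e \<in> responses (S i)")
    case True
    then show ?thesis using p q(1) mono[OF _ lts(2)] unfolding proc_inv_def by force
  next
    case False
    then show ?thesis using that q(2) mono[OF _ lts(1)] ack.hyps(5) by blast
  qed
  then have proc: "proc_inv n ?S ph A G W i"
    using p q(1) op_inv_extends[OF E] lts unfolding proc_inv_def by auto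
  show ?case
  proof (rule state_inv_step[where i = i, OF IH E reach_G_mono[OF Re]])
    show "(x, tvps (?S i) x) \<in> W \<and> fst (fst (tvps (?S i) x)) \<le> lt (?S i)" for x
      using IH lts(2) unfolding state_inv_def by (auto intro: le_trans)
  qed (use proc in \<open>auto dest: in_diffD\<close>)
next
  case (ack_quorum S N ph A G W D H j i l r l' R)
  note Re = ack_quorum.hyps(1) and IH = ack_quorum.IH
  let ?S = "S(i := (S i)\<lparr>lt := l', responses := {}, rid := r + 1, busy := False\<rparr>)"
  let ?ph = "ph(i := Idle)" and ?d = "(A i)\<lparr>fin := l'\<rparr>"
  have E: "extends S G W ?S G W" using ack_quorum.hyps(4) by (intro extends_same_G) auto
  have q: "ph i = Updating" "stored G (A i) j l"
    using IH ack_quorum.hyps(2,3) by (fastforce simp: state_inv_def)+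
  have p: "proc_inv n S ph A G W i" using IH by (simp add: state_inv_def)
  have lts: "l \<le> l'" "lt (S i) < l'" using ack_quorum.hyps(4) by auto
  have mono: "stored G d k l'" if "stored G d k l''" "l'' \<le> l'" for d k l''
    using that reach_G_mono[OF Re] unfolding stored_def by (meson order_trans)
  have st: "\<exists>k. e = RespA k \<and> stored G (A i) k l'" if "e \<in> R" for e
  proof (cases "e \<in> responses (S i)")
    case True
    then show ?thesis using p q(1) mono[OF _ less_imp_le[OF lts(2)]] unfolding proc_inv_def by force
  next
    case False
    then show ?thesis using that q(2) mono[OF _ lts(1)] ack_quorum.hyps(5) by blast
  qed
  have "majority n (sender ` R)"
    using reach_majority[OF Re ack_quorum.hyps(2), of i "RespA j"] ack_quorum.hyps(3,5,6) by simp
  \<comment> \<open>Every member of the quorum stored the stamp at a time known to \<open>i\<close>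
    by now, thus at most \<open>l'\<close>, the value of \<open>fin\<close>.\<close>
  moreover have "\<forall>k\<in>sender ` R. stored G ?d k (fin ?d)"
    using st by (fastforce simp: stored_def)
  moreover have "op_inv n ?S G W ?d"
    using p q(1) op_inv_extends[OF E, of n "A i"] by (simp add: proc_inv_def op_inv_def read_quorum_def)
  ultimately have "done_inv n ?S G W ?d"
    using p q(1) lts unfolding done_inv_def proc_inv_def by (auto simp del: fun_upd_apply simp: fun_upd_same)
  moreover have "proc_inv n ?S ?ph A G W i" by (simp add: proc_inv_def)
  moreover have "owner m \<noteq> (i, r + 1)" if "m \<in># N" for m
    using reach_rid[OF Re that] ack_quorum.hyps(3) by auto
  moreover have "(x, tvps (?S i) x) \<in> W \<and> fst (fst (tvps (?S i) x)) \<le> lt (?S i)" for x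
    using IH less_imp_le[OF lts(2)] unfolding state_inv_def by (auto intro: le_trans)
  ultimately show ?case
    by (intro state_inv_step[where i = i, OF IH E reach_G_mono[OF Re]])
      (auto simp: proc_inv_def dest!: in_diffD)
qed

section \<open>Completed operations and the history\<close>

lemma reach_response_pending:
  assumes "reach n S N ph A G W D H" "Msg j i (Response l r u) \<in># N" "rid (S i) = r"
  shows "busy (S i)" "is_read (act (A i))"
proof -
  have "msg_inv S ph A G W (Msg j i (Response l r u))" "proc_inv n S ph A G W i"
    using reach_state_inv[OF assms(1)] assms(2) unfolding state_inv_def by blast+
  then show "busy (S i)" "is_read (act (A i))" using assms(3) by (simp_all add: proc_inv_def)
qed

lemma reach_ack_pending:
  assumes "reach n S N ph A G W D H" "Msg j i (Ack l r) \<in># N" "rid (S i) = r"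
  shows "busy (S i)" "agent (A i) = i" "reading (S i) = is_read (act (A i))"
    "reading (S i) \<Longrightarrow> rval (S i) = snd (stamp (A i))"
proof -
  have "msg_inv S ph A G W (Msg j i (Ack l r))" "proc_inv n S ph A G W i"
    using reach_state_inv[OF assms(1)] assms(2) unfolding state_inv_def by blast+
  then show "busy (S i)" "agent (A i) = i" "reading (S i) = is_read (act (A i))"
    "reading (S i) \<Longrightarrow> rval (S i) = snd (stamp (A i))"
    using assms(3) by (simp_all add: proc_inv_def)
qed

lemma reach_done_inv:
  "reach n S N ph A G W D H \<Longrightarrow> d \<in> set D \<Longrightarrow> done_inv n S G W d"
  using reach_state_inv unfolding state_inv_def by blast

text \<open>\<open>D\<close> is in order of completion. An invocation sets \<open>ini\<close> to one
  more than the clock, and the clock is at least \<open>fin\<close> of every completed operation of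
  the process.\<close>

lemma reach_order:
  "reach n S N ph A G W D H \<Longrightarrow>
     sorted_wrt (\<lambda>d d'. agent d = agent d' \<longrightarrow> fin d < ini d') D \<and>
     (\<forall>i. busy (S i) \<longrightarrow> (\<forall>d\<in>set D. agent d = i \<longrightarrow> fin d < ini (A i)))"
proof (induction rule: reach.induct)
  case init
  then show ?case by simp
next
  case (invoke_read S N ph A G W D H i l' r' x)
  then show ?case using reach_done_inv[OF invoke_read.hyps(1)] by (force simp: done_inv_def)
next
  case (invoke_write S N ph A G W D H i l' r' x v)
  then show ?case using reach_done_inv[OF invoke_write.hyps(1)] by (force simp: done_inv_def)
next
  case (ack_quorum S N ph A G W D H j i l r l' R)
  then show ?case using reach_ack_pending[OF ack_quorum.hyps(1-3)] by (auto simp: sorted_wrt_append)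
qed auto

text \<open>The last alternative is a write still in progress, whose stamp may already have been
  read by others; it is void at the end of a complete history.\<close>

definition written where
  "written S A D x u \<longleftrightarrow> u = ((0, 0), 0) \<or> (\<exists>d\<in>set D. act d = Write x (snd u) \<and> stamp d = u) \<or>
     (\<exists>i. busy (S i) \<and> act (A i) = Write x (snd u) \<and> stamp (A i) = u)"

lemma written_mono:
  assumes "written S A D x u" "set D \<subseteq> set D'"
    "\<And>i. busy (S i) \<Longrightarrow> \<not> is_read (act (A i)) \<Longrightarrow> busy (S' i) \<and> act (A' i) = act (A i) \<and> stamp (A' i) = stamp (A i)"
  shows "written S' A' D' x u"
  using assms unfolding written_def by (metis is_read.simps(2) subset_iff)

lemma reach_written: "reach n S N ph A G W D H \<Longrightarrow> (x, u) \<in> W \<Longrightarrow> written S A D x u"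
proof (induction arbitrary: x u rule: reach.induct)
  case init
  then show ?case by (simp add: written_def)
next
  case (invoke_read S N ph A G W D H i l' r' x y u)
  show ?case
    by (rule written_mono[OF invoke_read.IH[OF invoke_read.prems]]) (use invoke_read.hyps(3) in auto)
next
  case (invoke_write S N ph A G W D H i l' r' x v y u)
  show ?case
  proof (cases "(y, u) = (x, ((l', i), v))")
    case True
    then show ?thesis unfolding written_def by (intro disjI2 exI[of _ i]) simp
  next
    case False
    then have "(y, u) \<in> W" using invoke_write.prems by blast
    from invoke_write.IH[OF this] show ?thesis
      by (rule written_mono) (use invoke_write.hyps(3) in auto)
  qed
next
  case (response_quorum S N ph A G W D H j i l r u l' R tv r' y w)
  \<comment> \<open>The stamp that changes here is that of a read.\<close>
  show ?case
    by (rule written_mono[OF response_quorum.IH[OF response_quorum.prems]])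
      (use reach_response_pending[OF response_quorum.hyps(1-3)] in auto)
next
  case (ack_quorum S N ph A G W D H j i l r l' R y w)
  show ?case
  proof (cases "act (A i) = Write y (snd w) \<and> stamp (A i) = w")
    case True
    then show ?thesis unfolding written_def by simp
  next
    case False
    then show ?thesis using ack_quorum.IH[OF ack_quorum.prems] unfolding written_def by auto
  qed
next
  case (query S N ph A G W D H j i l r x l' y w)
  show ?case by (rule written_mono[OF query.IH[OF query.prems]]) auto
next
  case (update S N ph A G W D H j i l r x u l' u' y w)
  show ?case by (rule written_mono[OF update.IH[OF update.prems]]) auto
next
  case (response S N ph A G W D H j i l r u l' R y w)
  show ?case by (rule written_mono[OF response.IH[OF response.prems]]) auto
next
  case (ack S N ph A G W D H j i l r l' R y w)
  show ?case by (rule written_mono[OF ack.IH[OF ack.prems]]) auto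
qed auto

definition op_events :: "opr \<Rightarrow> event list" where
  "op_events d = [Inv (agent d) (act d),
     Res (agent d) (if is_read (act d) then RVal (snd (stamp d)) else ROK)]"

text \<open>A completing read returns \<open>rval\<close>, which is the value in its stamp, so the
  events of an operation are determined by its record.\<close>

lemma reach_history:
  "reach n S N ph A G W D H \<Longrightarrow> proj H i =
     concat (map op_events (filter (\<lambda>d. agent d = i) D)) @ (if busy (S i) then [Inv i (act (A i))] else [])"
proof (induction arbitrary: i rule: reach.induct)
  case init
  then show ?case by (simp add: proj_def init_lstate_def)
next
  case (ack_quorum S N ph A G W D H j k l r l' R)
  then show ?case using reach_ack_pending[OF ack_quorum.hyps(1-3)]
    by (auto simp: proj_def op_events_def)
qed (auto simp: proj_def)

lemma filter_eq_snocD: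
  "filter P xs = ys @ [y] \<Longrightarrow> \<exists>us vs. xs = us @ y # vs \<and> P y \<and> (\<forall>v\<in>set vs. \<not> P v)"
proof (induction xs arbitrary: ys)
  case (Cons x xs)
  show ?case
  proof (cases "P x \<and> ys = []")
    case True
    then show ?thesis using Cons.prems by (intro exI[of _ "[]"] exI[of _ xs]) (auto simp: filter_empty_conv)
  next
    case False
    then obtain ys' where "filter P xs = ys' @ [y]"
      using Cons.prems by (cases ys) (auto split: if_splits)
    from Cons.IH[OF this] show ?thesis by (metis append_Cons)
  qed
qed simp

lemma complete_hist_proj_snoc:
  assumes "complete_hist H" "proj H i = ys @ [e]"
  shows "\<not> is_inv e"
proof
  assume e: "is_inv e"
  obtain us vs where H: "H = us @ e # vs" "ev_proc e = i" "\<forall>v\<in>set vs. ev_proc v \<noteq> i"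
    using filter_eq_snocD[OF assms(2)[unfolded proj_def]] by blast
  then obtain k' where k': "length us < k'" "k' < length H" "ev_proc (H ! k') = ev_proc (H ! length us)"
    using assms(1) e unfolding complete_hist_def
    by (metis (no_types) length_append length_Cons less_add_same_cancel1 nth_append_length zero_less_Suc)
  then have "H ! k' = vs ! (k' - length us - 1)" "k' - length us - 1 < length vs"
    using H by (auto simp: nth_append)
  then show False using k' H by (metis nth_append_length nth_mem)
qed

text \<open>An outstanding operation would make an invocation the last event of its process.\<close>

lemma reach_complete:
  assumes "reach n S N ph A G W D H" "complete_hist H"
  shows "\<not> busy (S i)"
  using reach_history[OF assms(1), of i] complete_hist_proj_snoc[OF assms(2), of i] by auto

section \<open>Linearization in logical time\<close>

definition start :: "opr \<Rightarrow> ts" where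
  "start d = (ini d, agent d)"

definition finish :: "opr \<Rightarrow> ts" where
  "finish d = (fin d, agent d)"

text \<open>Since \<open>False < True\<close>, a write comes before the reads that return its
  timestamp. The start orders reads of the same timestamp.\<close>

definition rank :: "opr \<Rightarrow> ts \<times> bool \<times> ts" where
  "rank d = (fst (stamp d), is_read (act d), start d)"

text \<open>
  The rank orders the operations on one register. The point is a common choice of
  linearization points for all registers: an operation is placed at the earliest time compatible with its
  rank, i.e. at the latest start of an operation that has to come no later.
\<close>
definition lin_point :: "opr list \<Rightarrow> opr \<Rightarrow> ts" where
  "lin_point D d = Max (start ` {d' \<in> set D. op_reg (act d') = op_reg (act d) \<and> rank d' \<le> rank d})"

text \<open>Operations on one register may share a point; the rank breaks such ties, so that sorting
  by this key sorts each register by rank.\<close>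

definition lin_key :: "opr list \<Rightarrow> opr \<Rightarrow> ts \<times> ts \<times> bool \<times> ts" where
  "lin_key D d = (lin_point D d, rank d)"

text \<open>What is left of a reachable state at the end of a complete history: nothing is
  outstanding, so every entry other than the initial one belongs to a completed write.\<close>

locale done_ops =
  fixes D :: "opr list" and n :: nat and S :: "proc \<Rightarrow> lstate" and G W
  assumes dones: "d \<in> set D \<Longrightarrow> done_inv n S G W d"
    and order: "sorted_wrt (\<lambda>d d'. agent d = agent d' \<longrightarrow> fin d < ini d') D"
    and written: "(x, u) \<in> W \<Longrightarrow> u = ((0, 0), 0) \<or> (\<exists>d\<in>set D. act d = Write x (snd u) \<and> stamp d = u)"
    and G_mono: "l \<le> l' \<Longrightarrow> G k l x \<le> G k l' x"
begin

lemma start_less_finish: "d \<in> set D \<Longrightarrow> start d < finish d"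
  using dones[of d] by (simp add: done_inv_def start_def finish_def)

lemma stamp_less_finish: "d \<in> set D \<Longrightarrow> fst (stamp d) < finish d"
  using dones[of d] by (simp add: done_inv_def finish_def less_prod_def)

lemma write_stamp: "d \<in> set D \<Longrightarrow> act d = Write x v \<Longrightarrow> stamp d = (start d, v)"
  using dones[of d] by (simp add: done_inv_def op_inv_def start_def)

text \<open>Two positions of \<open>D\<close> with the same start would belong to one process, and
  the operation would have to finish before its own start.\<close>

lemma start_inj:
  assumes "d \<in> set D" "d' \<in> set D" "start d = start d'"
  shows "d = d'"
proof -
  obtain i j where ij: "i < length D" "D ! i = d" "j < length D" "D ! j = d'"
    using assms by (metis in_set_conv_nth)
  have lt: False if "i < j" "j < length D" "start (D ! i) = start (D ! j)" for i j
  proof -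
    have "agent (D ! i) = agent (D ! j)" "ini (D ! i) = ini (D ! j)" using that by (auto simp: start_def)
    then have "fin (D ! i) < ini (D ! i)" using sorted_wrt_nth_less[OF order that(1,2)] by simp
    moreover have "ini (D ! i) < fin (D ! i)" using dones[of "D ! i"] that by (simp add: done_inv_def)
    ultimately show False by simp
  qed
  then have "i = j" using ij assms(3) by (metis nat_neq_iff)
  then show ?thesis using ij by simp
qed

lemma read_after:
  assumes "d \<in> set D" "d' \<in> set D" "op_reg (act d) = op_reg (act d')" "is_read (act d')" "finish d < start d'"
  shows "fst (stamp d) \<le> fst (stamp d')"
proof -
  obtain Q where Q: "majority n Q" "\<forall>k\<in>Q. stored G d k (fin d)"
    using dones[OF assms(1)] by (auto simp: done_inv_def)
  obtain Q' where Q': "majority n Q'" "\<forall>k\<in>Q'. G k (ini d') (op_reg (act d')) \<le> stamp d'"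
    using dones[OF assms(2)] assms(4) by (auto simp: done_inv_def op_inv_def read_quorum_def)
  have "Q \<inter> Q' \<noteq> {}"
  proof
    assume "Q \<inter> Q' = {}"
    moreover have "finite Q" "finite Q'" using Q Q' by (auto simp: majority_def intro: finite_subset)
    ultimately have "card (Q \<union> Q') = 2 * (n div 2 + 1)"
      using Q Q' by (simp add: majority_def card_Un_disjoint)
    moreover have "card (Q \<union> Q') \<le> n"
      using Q Q' card_mono[of "{1..n}" "Q \<union> Q'"] by (simp add: majority_def)
    ultimately have "2 * (n div 2 + 1) \<le> n" by simp
    then show False by presburger
  qed
  then obtain k where "k \<in> Q" "k \<in> Q'" by blast
  \<comment> \<open>Process ids break ties, so the two clocks may be equal; the weak inequality
    suffices for \<open>G_mono\<close>.\<close>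
  moreover have "fin d \<le> ini d'" using assms(5) by (auto simp: finish_def start_def)
  ultimately have "stamp d \<le> stamp d'"
    using Q Q' assms(3) G_mono unfolding stored_def by (metis order_trans)
  then show ?thesis by (cases "stamp d"; cases "stamp d'") auto
qed

text \<open>A write is stamped with its start, which exceeds \<open>finish d\<close> and hence the
  timestamp of \<open>d\<close>. For a read, \<open>read_after\<close> gives a weak inequality that
  the other components of the rank make strict.\<close>

lemma rank_less:
  assumes "d \<in> set D" "d' \<in> set D" "op_reg (act d) = op_reg (act d')" "finish d < start d'"
  shows "rank d < rank d'"
proof (cases "act d'")
  case (Read x)
  have "fst (stamp d) \<le> fst (stamp d')" using read_after[OF assms(1-3) _ assms(4)] Read by simp
  moreover have "start d < start d'" using start_less_finish[OF assms(1)] assms(4) by order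
  ultimately show ?thesis using Read by (auto simp: rank_def le_bool_def)
next
  case (Write x v)
  have "fst (stamp d) < fst (stamp d')"
    using stamp_less_finish[OF assms(1)] assms(4) write_stamp[OF assms(2) Write] by simp
  then show ?thesis unfolding rank_def less_prod_simp by blast
qed

text \<open>An operation on the register that starts after \<open>finish d\<close> ranks above
  \<open>d\<close> and is not among those whose starts are maximized.\<close>

lemma lin_point_bounds:
  assumes "d \<in> set D"
  shows "start d \<le> lin_point D d" "lin_point D d \<le> finish d"
proof -
  let ?X = "start ` {d' \<in> set D. op_reg (act d') = op_reg (act d) \<and> rank d' \<le> rank d}"
  have mem: "start d \<in> ?X" using assms by auto
  then show "start d \<le> lin_point D d" unfolding lin_point_def by (intro Max_ge) auto
  have "s \<le> finish d" if s: "s \<in> ?X" for s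
  proof (rule ccontr)
    assume "\<not> s \<le> finish d"
    moreover obtain d' where d': "s = start d'" "d' \<in> set D" "op_reg (act d') = op_reg (act d)" "rank d' \<le> rank d"
      using s by blast
    ultimately have "rank d < rank d'" using rank_less[OF assms d'(2)] by simp
    then show False using d'(4) by simp
  qed
  then show "lin_point D d \<le> finish d"
    unfolding lin_point_def using mem by (intro Max.boundedI) auto
qed

text \<open>A smaller rank means a maximum over a smaller set, so \<open>lin_point\<close> is
  monotone in the rank.\<close>

lemma rank_le_if_lin_key_le:
  assumes "d \<in> set D" "d' \<in> set D" "op_reg (act d) = op_reg (act d')" "lin_key D d \<le> lin_key D d'"
  shows "rank d \<le> rank d'"
proof (rule ccontr)
  assume "\<not> rank d \<le> rank d'"
  then have less: "rank d' < rank d" by simp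
  have "lin_point D d' \<le> lin_point D d"
    unfolding lin_point_def using assms(2,3) less by (intro Max_mono) (auto intro: order_trans)
  then have "lin_key D d' < lin_key D d" using less by (auto simp: lin_key_def)
  then show False using assms(4) by simp
qed

text \<open>Operations of one process occupy disjoint logical intervals containing their points, so
  the part of \<open>D\<close> that belongs to the process is sorted already.\<close>

lemma sort_filter_agent:
  "filter (\<lambda>d. agent d = i) (sort_key (lin_key D) D) = filter (\<lambda>d. agent d = i) D"
proof -
  have "lin_key D d \<le> lin_key D d'" if "d \<in> set D" "d' \<in> set D" "agent d = agent d'" "fin d < ini d'" for d d'
  proof -
    have "finish d < start d'" using that by (simp add: finish_def start_def)
    then have "lin_point D d < lin_point D d'"
      using lin_point_bounds[OF that(1)] lin_point_bounds[OF that(2)] by order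
    then show ?thesis by (simp add: lin_key_def)
  qed
  then have "sorted (map (lin_key D) (filter (\<lambda>d. agent d = i) D))"
    unfolding sorted_map
    by (intro sorted_wrt_mono_rel[OF _ sorted_wrt_filter[OF order]]) auto
  then show ?thesis by (simp add: filter_sort sort_key_id_if_sorted)
qed

end

section \<open>Sequential histories built from operations\<close>

lemma op_events_Cons: "concat (map op_events (d # L)) = Inv (agent d) (act d) #
    Res (agent d) (if is_read (act d) then RVal (snd (stamp d)) else ROK) # concat (map op_events L)"
  by (simp add: op_events_def)

lemma nth_op_events_Inv:
  assumes "Suc k < length (concat (map op_events L))" "concat (map op_events L) ! k = Inv i a"
  shows "\<exists>xs d ys. L = xs @ d # ys \<and> act d = a \<and> take k (concat (map op_events L)) = concat (map op_events xs) \<and>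
    concat (map op_events L) ! Suc k = Res (agent d) (if is_read a then RVal (snd (stamp d)) else ROK)"
  using assms
proof (induction L arbitrary: k)
  case (Cons d L)
  consider "k = 0" | "k = 1" | k' where "k = Suc (Suc k')" by (metis One_nat_def not0_implies_Suc)
  then show ?case
  proof cases
    case 1
    show ?thesis
      by (rule exI[of _ "[]"], rule exI[of _ d], rule exI[of _ L]) (use Cons.prems 1 in \<open>auto simp: op_events_def\<close>)
  next
    case 2
    then show ?thesis using Cons.prems by (simp add: op_events_def)
  next
    case 3
    then obtain xs d' ys where IH: "L = xs @ d' # ys" "act d' = a"
        "take k' (concat (map op_events L)) = concat (map op_events xs)"
        "concat (map op_events L) ! Suc k' = Res (agent d') (if is_read a then RVal (snd (stamp d')) else ROK)"
      using Cons.IH[of k'] Cons.prems[unfolded op_events_Cons] by auto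
    show ?thesis
      by (rule exI[of _ "d # xs"], rule exI[of _ d'], rule exI[of _ ys], unfold op_events_Cons)
        (simp add: 3 IH(2-4), simp add: IH(1))
  qed
qed simp

lemma sequential_op_events: "sequential_hist (concat (map op_events L))"
proof (induction L)
  case (Cons d L)
  have "(even k \<longrightarrow> is_inv (concat (map op_events (d # L)) ! k)) \<and>
      (odd k \<longrightarrow> is_res (concat (map op_events (d # L)) ! k) \<and>
        ev_proc (concat (map op_events (d # L)) ! k) = ev_proc (concat (map op_events (d # L)) ! (k - 1)))"
    if k: "k < length (concat (map op_events (d # L)))" for k
  proof -
    consider "k = 0" | "k = 1" | k' where "k = Suc (Suc k')" by (metis One_nat_def not0_implies_Suc)
    then show ?thesis
    proof cases
      case 3
      then have "k' < length (concat (map op_events L))" using k unfolding op_events_Cons by simp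
      then show ?thesis
        using Cons.IH[unfolded sequential_hist_def, rule_format, of k'] 3 unfolding op_events_Cons
        by (cases k') auto
    qed (auto simp: op_events_def)
  qed
  then show ?case unfolding sequential_hist_def by blast
qed (simp add: sequential_hist_def)

text \<open>\<open>last_write\<close> reads a reversed history, so \<open>es\<close> is the more
  recent part.\<close>

lemma last_write_append:
  "last_write x (es @ fs) = (if \<exists>i v. Inv i (Write x v) \<in> set es then last_write x es else last_write x fs)"
  by (induction es) (auto split: event.splits op.splits)

lemma last_write_op_events:
  assumes "\<And>d v. d \<in> set ys \<Longrightarrow> act d \<noteq> Write x v"
  shows "last_write x (rev (concat (map op_events ys))) = 0"
    and "act w = Write x v \<Longrightarrow> last_write x (rev (concat (map op_events (xs @ w # ys)))) = v"
proof -
  have no: "\<nexists>i v. Inv i (Write x v) \<in> set (rev (concat (map op_events ys)))"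
    using assms by (auto simp: op_events_def) metis
  have "last_write x es = 0" if "\<nexists>i v. Inv i (Write x v) \<in> set es" for es
    using that by (induction es) (auto split: event.splits op.splits)
  then show "last_write x (rev (concat (map op_events ys))) = 0" using no by blast
  show "last_write x (rev (concat (map op_events (xs @ w # ys)))) = v" if "act w = Write x v"
    using no that by (simp add: last_write_append op_events_def)
qed

context done_ops
begin

text \<open>The stamp of a read is the initial entry or that of a write \<open>w\<close>. In the
  second case \<open>w\<close> ranks below the read, and the last write before the read ranks
  between them, so it has the same timestamp; writes with equal timestamps coincide.\<close>

lemma legal_sort: "legal_hist (concat (map op_events (sort_key (lin_key D) D)))"
  unfolding legal_hist_def
proof (intro allI impI)
  let ?L = "sort_key (lin_key D) D"
  let ?E = "concat (map op_events ?L)"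
  fix k x
  assume "Suc k < length ?E" "\<exists>i. ?E ! k = Inv i (Read x)"
  then obtain xs d ys where L: "?L = xs @ d # ys" and d: "act d = Read x"
    and take: "take k ?E = concat (map op_events xs)" and res: "?E ! Suc k = Res (agent d) (RVal (snd (stamp d)))"
    using nth_op_events_Inv[of k ?L _ "Read x"] by auto
  have set: "set D = set xs \<union> {d} \<union> set ys" using arg_cong[OF L, of set] by auto
  have "sorted (map (lin_key D) (xs @ d # ys))" using sorted_sort_key[of "lin_key D" D] L by simp
  then have xs: "w \<in> set xs \<Longrightarrow> lin_key D w \<le> lin_key D d" and ys: "w \<in> set ys \<Longrightarrow> lin_key D d \<le> lin_key D w"
    and sorted: "sorted (map (lin_key D) xs)" for w by (auto simp: sorted_append)
  have before: "fst (stamp w) \<le> fst (stamp d)" if "w \<in> set xs" "act w = Write x v" for w v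
    using rank_le_if_lin_key_le[of w d] that set xs[OF that(1)] d by (auto simp: rank_def)
  have "(x, stamp d) \<in> W" using dones[of d] set d by (simp add: done_inv_def op_inv_def)
  then consider "stamp d = ((0, 0), 0)" | w where "w \<in> set D" "act w = Write x (snd (stamp d))" "stamp w = stamp d"
    using written by blast
  then have "snd (stamp d) = last_write x (rev (concat (map op_events xs)))"
  proof cases
    case 1
    have "act w \<noteq> Write x v" if "w \<in> set xs" for w v
    proof
      assume w: "act w = Write x v"
      have "w \<in> set D" using that set by simp
      \<comment> \<open>Process ids start at 1, so the timestamp of a write cannot be
        \<open>(0, 0)\<close> or less.\<close>
      then have "fst (stamp w) = start w" "1 \<le> agent w"
        using write_stamp[OF _ w] dones[of w] by (auto simp: done_inv_def op_inv_def)
      then show False using before[OF that w] 1 by (simp add: start_def less_eq_prod_def)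
    qed
    then show ?thesis using 1 last_write_op_events(1)[of xs x] by simp
  next
    case 2
    have "w \<in> set xs"
    proof -
      \<comment> \<open>The timestamps agree, and the second component puts the write first.\<close>
      have "rank w < rank d" using 2 d by (simp add: rank_def)
      then have "\<not> lin_key D d \<le> lin_key D w"
        using rank_le_if_lin_key_le[of d w] 2 d set by auto
      then show ?thesis using 2(1) set ys by auto
    qed
    then obtain as w' bs v where xs_split: "xs = as @ w' # bs" and w': "act w' = Write x v"
      and bs: "\<forall>z\<in>set bs. \<forall>v. act z \<noteq> Write x v"
      using split_list_last_prop[of xs "\<lambda>w. \<exists>v. act w = Write x v"] 2(2) by blast
    have in_D: "w' \<in> set D" using xs_split set by simp
    have "w' = w"
    proof (rule ccontr)
      assume "w' \<noteq> w"
      then have "w \<in> set as" using \<open>w \<in> set xs\<close> xs_split bs 2(2) by auto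
      then have "lin_key D w \<le> lin_key D w'" using sorted xs_split by (auto simp: sorted_append)
      then have "fst (stamp w) \<le> fst (stamp w')"
        using rank_le_if_lin_key_le[of w w'] 2 w' in_D by (auto simp: rank_def)
      moreover have "fst (stamp w') \<le> fst (stamp w)"
        using before[of w' v] w' xs_split 2(3) by simp
      ultimately have "start w = start w'"
        using write_stamp[OF 2(1,2)] write_stamp[OF in_D w'] by simp
      then show False using start_inj[OF 2(1) in_D] \<open>w' \<noteq> w\<close> by simp
    qed
    then show ?thesis
      using last_write_op_events(2)[of bs x w' v as] bs w' xs_split 2(2) by simp
  qed
  then show "\<exists>i. ?E ! Suc k = Res i (RVal (last_write x (rev (take k ?E))))"
    using res take by simp
qed

end

section \<open>Sequential consistency\<close>

lemma reach_init:
  "reach n (ls init_cfg) (net init_cfg) (\<lambda>_. Idle) (\<lambda>_. undefined) (\<lambda>_ _ _. ((0, 0), 0)) (UNIV \<times> {((0, 0), 0)}) [] []"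
  using reach.init by (simp add: init_cfg_def)

lemma seq_consistent_run:
  assumes "valid_run n f init_cfg as" "complete_hist (run_history n init_cfg as)"
  shows "seq_consistent (run_history n init_cfg as)"
proof -
  let ?H = "run_history n init_cfg as"
  obtain S N ph A G W D where R: "reach n S N ph A G W D ?H"
    using reach_run[OF reach_init assms(1)] by auto
  note idle = reach_complete[OF R assms(2)]
  interpret done_ops D n S G W
  proof
    show "u = ((0, 0), 0) \<or> (\<exists>d\<in>set D. act d = Write x (snd u) \<and> stamp d = u)" if "(x, u) \<in> W" for x u
      using reach_written[OF R that] idle unfolding written_def by blast
  qed (use reach_done_inv[OF R] reach_order[OF R] reach_G_mono[OF R] in auto)
  let ?L = "sort_key (lin_key D) D"
  have proj_ops: "proj (concat (map op_events xs)) i = concat (map op_events (filter (\<lambda>d. agent d = i) xs))" for xs i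
    by (induction xs) (auto simp: proj_def op_events_def)
  have "equiv_hist (concat (map op_events ?L)) ?H"
    unfolding equiv_hist_def
    using reach_history[OF R] idle by (simp add: proj_ops sort_filter_agent)
  then show ?thesis
    unfolding seq_consistent_def using sequential_op_events legal_sort by blast
qed

section \<open>Termination\<close>

fun is_request :: "msg \<Rightarrow> bool" where
  "is_request (Msg i j (Query l r x)) = True"
| "is_request (Msg i j (Update l r x u)) = True"
| "is_request (Msg i j (Response l r u)) = False"
| "is_request (Msg i j (Ack l r)) = False"

text \<open>Tells the phase a message belongs to, hence acks count as well.\<close>

fun is_update :: "msg \<Rightarrow> bool" where
  "is_update (Msg i j (Query l r x)) = False"
| "is_update (Msg i j (Update l r x u)) = True"
| "is_update (Msg i j (Response l r u)) = False"
| "is_update (Msg i j (Ack l r)) = True"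

lemma src_dst_owner_peer:
  "src m = (if is_request m then fst (owner m) else peer m)"
  "dst m = (if is_request m then peer m else fst (owner m))"
  by (cases m rule: owner.cases; simp)+

section \<open>Effects of a single step\<close>

lemma step_crashed:
  "crashed (fst (exec_step n c a)) = (case a of Crash i \<Rightarrow> insert i (crashed c) | _ \<Rightarrow> crashed c)"
proof (cases a)
  case (Invoke i o')
  then show ?thesis by (cases o') (auto simp: Let_def)
qed (auto split: prod.splits)

lemma step_reply:
  assumes "is_request m"
  shows "\<exists>m'. m' \<in># net (fst (exec_step n c (Deliver m))) \<and> owner m' = owner m \<and> peer m' = peer m \<and> \<not> is_request m'"
  using assms by (cases m rule: owner.cases) (auto simp: Let_def)

text \<open>A reply with the current id is either collected or completes a quorum, and the latter
  changes the id.\<close>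

lemma step_collect:
  assumes "\<not> is_request m" "owner m = (i, rid (ls c i))" "rid (ls (fst (exec_step n c (Deliver m))) i) = rid (ls c i)"
  shows "\<exists>e\<in>responses (ls (fst (exec_step n c (Deliver m))) i). sender e = peer m"
  using assms by (cases m rule: owner.cases) (auto simp: Let_def split: if_splits)

lemma step_responses_mono:
  assumes "rid (ls (fst (exec_step n c a)) i) = rid (ls c i)"
  shows "responses (ls c i) \<subseteq> responses (ls (fst (exec_step n c a)) i)"
proof (cases a)
  case (Invoke i o')
  then show ?thesis using assms by (cases o') (auto simp: Let_def split: if_splits)
next
  case (Deliver m)
  then show ?thesis using assms
    by (cases m rule: owner.cases) (auto simp: Let_def split: if_splits)
qed auto

lemma step_busy:
  assumes "rid (ls (fst (exec_step n c a)) i) = rid (ls c i)" "busy (ls c i)"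
  shows "busy (ls (fst (exec_step n c a)) i)"
proof (cases a)
  case (Invoke i o')
  then show ?thesis using assms by (cases o') (auto simp: Let_def split: if_splits)
next
  case (Deliver m)
  then show ?thesis using assms
    by (cases m rule: owner.cases) (auto simp: Let_def split: if_splits)
qed (use assms in auto)

text \<open>A broadcast raises the id of its owner; with that id unchanged, a new message is a reply
  and inherits owner and phase from its request.\<close>

lemma step_net_origin:
  assumes "enabled n f c a" "m \<in># net (fst (exec_step n c a))" "i = fst (owner m)"
    "rid (ls (fst (exec_step n c a)) i) = rid (ls c i)"
  shows "\<exists>m'. m' \<in># net c \<and> owner m' = owner m \<and> is_update m' = is_update m"
proof (cases "m \<in># net c")
  case False
  show ?thesis
  proof (cases a)
    case (Invoke i o')
    then show ?thesis using assms False by (cases o') (auto simp: Let_def split: if_splits)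
  next
    case (Deliver m')
    then have "m' \<in># net c" using assms(1) by simp
    moreover have "owner m' = owner m \<and> is_update m' = is_update m"
      using assms(2-) False Deliver
      by (cases m' rule: owner.cases; cases m rule: owner.cases)
        (auto simp: Let_def split: if_splits dest!: in_diffD)
    ultimately show ?thesis by blast
  qed (use assms False in auto)
qed auto

text \<open>Local states do not record the phase, so it is read off the messages in transit;
  \<open>b\<close> marks an update phase.\<close>

definition in_phase :: "cfg \<Rightarrow> proc \<Rightarrow> nat \<Rightarrow> bool \<Rightarrow> bool" where
  "in_phase c i r b \<longleftrightarrow> rid (ls c i) = r \<and> busy (ls c i) \<and>
     (\<forall>m. m \<in># net c \<longrightarrow> owner m = (i, r) \<longrightarrow> is_update m = b)"

definition requested :: "nat \<Rightarrow> cfg \<Rightarrow> proc \<Rightarrow> nat \<Rightarrow> bool" where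
  "requested n c i r \<longleftrightarrow> (\<forall>k\<in>{1..n}. \<exists>m. m \<in># net c \<and> owner m = (i, r) \<and> peer m = k \<and> is_request m)"

lemma step_in_phase:
  assumes "in_phase c i r b" "enabled n f c a" "rid (ls (fst (exec_step n c a)) i) = r"
  shows "in_phase (fst (exec_step n c a)) i r b"
  unfolding in_phase_def
proof (intro conjI allI impI)
  show "busy (ls (fst (exec_step n c a)) i)" using step_busy assms by (simp add: in_phase_def)
next
  fix m assume "m \<in># net (fst (exec_step n c a))" "owner m = (i, r)"
  then show "is_update m = b"
    using step_net_origin[OF assms(2), of m i] assms(1,3) unfolding in_phase_def by auto
qed (fact assms(3))

text \<open>The id of a busy process changes only when a reply completes a quorum, and
  \<open>b\<close> tells which kind of reply that is. A query quorum starts the update phase of the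
  same operation under a fresh id.\<close>

lemma step_phase_change:
  assumes R: "reach n (ls c) (net c) ph A G W D H" and ph: "in_phase c i r b" and en: "enabled n f c a"
    and ch: "rid (ls (fst (exec_step n c a)) i) \<noteq> r"
  shows "if b then \<exists>v. Res i v \<in> set (snd (exec_step n c a))
    else in_phase (fst (exec_step n c a)) i (r + 1) True \<and> requested n (fst (exec_step n c a)) i (r + 1)"
proof (cases a)
  case (Invoke k o')
  then show ?thesis using ph en ch by (cases o') (auto simp: Let_def in_phase_def split: if_splits)
next
  case (Deliver m)
  have old: "owner m' \<noteq> (i, r + 1)" if "m' \<in># net c" for m'
    using reach_rid[OF R that] ph by (auto simp: in_phase_def)
  have m: "m \<in># net c" using en Deliver by simp
  show ?thesis
  proof (cases m rule: owner.cases)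
    case (3 j k l q u)
    then have k: "k = i" "q = r" using ch ph Deliver by (auto simp: Let_def in_phase_def split: if_splits)
    then have b: "\<not> b" using ph m 3 unfolding in_phase_def by fastforce
    have quorum: "card (insert (RespQ u j) (responses (ls c i))) = n div 2 + 1"
      using ch ph Deliver 3 k by (auto simp: Let_def in_phase_def split: if_splits)
    let ?c = "fst (exec_step n c a)"
    have eqs: "rid (ls ?c i) = r + 1" "busy (ls ?c i)"
      using quorum ph Deliver 3 k by (auto simp: Let_def in_phase_def)
    obtain l' x w where net: "net ?c = net c - {#m#} + bcast n i (Update l' (r + 1) x w)"
      using quorum ph Deliver 3 k by (auto simp: Let_def in_phase_def)
    have "in_phase ?c i (r + 1) True"
      using eqs old unfolding in_phase_def net by (auto dest: in_diffD)
    moreover have "requested n ?c i (r + 1)"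
      unfolding requested_def net by auto
    ultimately show ?thesis using b by simp
  next
    case (4 j k l q)
    then have k: "k = i" "q = r" using ch ph Deliver by (auto simp: Let_def in_phase_def split: if_splits)
    then have b: "b" using ph m 4 unfolding in_phase_def by fastforce
    then show ?thesis
      using ch ph Deliver 4 k by (auto simp: Let_def in_phase_def split: if_splits)
  qed (use ch ph Deliver in \<open>auto simp: Let_def in_phase_def split: if_splits\<close>)
qed (use ch ph in \<open>auto simp: in_phase_def\<close>)

lemma step_invoke_phase:
  assumes R: "reach n (ls c) (net c) ph A G W D H" and en: "enabled n f c (Invoke i o')"
  shows "\<exists>r b. in_phase (fst (exec_step n c (Invoke i o'))) i r b \<and> requested n (fst (exec_step n c (Invoke i o'))) i r"
proof -
  let ?r = "rid (ls c i) + 1"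
  have old: "owner m \<noteq> (i, ?r)" if "m \<in># net c" for m
    using reach_rid[OF R that] by auto
  show ?thesis
  proof (cases o')
    case (Read x)
    then show ?thesis using old
      by (intro exI[of _ ?r] exI[of _ False]) (auto simp: Let_def in_phase_def requested_def)
  next
    case (Write x v)
    then show ?thesis using old
      by (intro exI[of _ ?r] exI[of _ True]) (auto simp: Let_def in_phase_def requested_def)
  qed
qed

section \<open>Fair executions\<close>

locale fair_run =
  fixes n f :: nat and C L
  assumes exec: "is_execution n f C L" and fair: "fair_execution n C L" and minority: "2 * f < n"
begin

lemma step: "enabled n f (C t) (L t)" "C (Suc t) = fst (exec_step n (C t) (L t))"
  using exec by (auto simp: is_execution_def)

lemma reach_at: "\<exists>ph A G W D H. reach n (ls (C t)) (net (C t)) ph A G W D H"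
proof (induction t)
  case 0
  then show ?case using reach_init exec unfolding is_execution_def by fastforce
next
  case (Suc t)
  then show ?case using reach_exec_step[OF _ step(1)] step(2) by metis
qed

lemma crashed_bound: "crashed (C t) \<subseteq> {1..n} \<and> card (crashed (C t)) \<le> f"
proof (induction t)
  case 0
  then show ?case using exec by (simp add: is_execution_def init_cfg_def)
next
  case (Suc t)
  have "finite (crashed (C t))" using Suc finite_subset by blast
  then show ?case using Suc step(1)[of t]
    by (cases "L t") (auto simp: step(2) step_crashed simp del: exec_step.simps)
qed

lemma crashed_mono: "t \<le> t' \<Longrightarrow> crashed (C t) \<subseteq> crashed (C t')"
  by (rule lift_Suc_mono_le[of "\<lambda>t. crashed (C t)"]) (auto simp: step(2) step_crashed simp del: exec_step.simps split: label.splits)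

text \<open>The crashed sets grow within a finite set, so their union is one of them and has at most
  \<open>f\<close> members.\<close>

lemma card_correct: "n div 2 < card {k. correct_proc n C k}"
proof -
  let ?U = "\<Union>t. crashed (C t)"
  have fin: "finite ?U" using crashed_bound by (intro finite_subset[of ?U "{1..n}"]) auto
  obtain T where T: "\<And>i. i \<in> ?U \<Longrightarrow> i \<in> crashed (C (T i))" by (metis UN_E)
  have "?U \<subseteq> crashed (C (Max (T ` ?U)))"
  proof
    fix i assume i: "i \<in> ?U"
    then have "T i \<le> Max (T ` ?U)" using fin by (intro Max_ge) auto
    then show "i \<in> crashed (C (Max (T ` ?U)))" using crashed_mono T[OF i] by blast
  qed
  then have "card ?U \<le> f" using crashed_bound finite_subset
    by (metis (no_types, lifting) card_mono finite_atLeastAtMost le_trans)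
  moreover have "{k. correct_proc n C k} = {1..n} - ?U" by (auto simp: correct_proc_def)
  moreover have "card ({1..n} - ?U) = n - card ?U"
    using crashed_bound fin by (subst card_Diff_subset) auto
  moreover have "n div 2 < n - c" if "c \<le> f" for c using that minority by presburger
  ultimately show ?thesis by simp
qed

lemma eventually_delivered:
  assumes "m \<in># net (C t)" "correct_proc n C (src m)" "correct_proc n C (dst m)"
  shows "\<exists>t'\<ge>t. L t' = Deliver m"
  using fair assms unfolding fair_execution_def by blast

lemma rid_changes:
  assumes req: "requested n (C t) i r" and i: "correct_proc n C i"
  shows "\<exists>t'\<ge>t. rid (ls (C t') i) \<noteq> r"
proof (rule ccontr)
  assume "\<not> ?thesis"
  then have same: "rid (ls (C s) i) = r" if "t \<le> s" for s using that by blast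
  let ?K = "{k. correct_proc n C k}"
  have mono: "responses (ls (C s) i) \<subseteq> responses (ls (C s') i)" if "t \<le> s" "s \<le> s'" for s s'
    using that(2)
  proof (induction s' rule: dec_induct)
    case (step s')
    then have "responses (ls (C s') i) \<subseteq> responses (ls (C (Suc s')) i)"
      unfolding fair_run.step(2)[OF fair_run_axioms]
      using same that(1) by (intro step_responses_mono) (simp flip: fair_run.step(2)[OF fair_run_axioms])
    then show ?case using step.IH by blast
  qed simp
  have "\<exists>s\<ge>t. k \<in> sender ` responses (ls (C s) i)" if k: "correct_proc n C k" for k
  proof -
    have "k \<in> {1..n}" using k by (simp add: correct_proc_def)
    then obtain m where m: "m \<in># net (C t)" "owner m = (i, r)" "peer m = k" "is_request m"
      using req unfolding requested_def by blast
    then obtain t1 where t1: "t \<le> t1" "L t1 = Deliver m"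
      using eventually_delivered[OF m(1)] i k by (auto simp: src_dst_owner_peer)
    obtain m' where m': "m' \<in># net (C (Suc t1))" "owner m' = (i, r)" "peer m' = k" "\<not> is_request m'"
      using step_reply[OF m(4), of n "C t1"] m t1 step(2)[of t1] by auto
    then obtain t2 where t2: "Suc t1 \<le> t2" "L t2 = Deliver m'"
      using eventually_delivered[OF m'(1)] i k by (auto simp: src_dst_owner_peer)
    have "t \<le> t2" using t1 t2 by simp
    then have "\<exists>e\<in>responses (ls (C (Suc t2)) i). sender e = peer m'"
      unfolding step(2)[of t2] t2(2)
      using m'(2) same[of t2] same[of "Suc t2"] step(2)[of t2] t2(2) by (intro step_collect[OF m'(4)]) simp_all
    then show ?thesis using \<open>t \<le> t2\<close> m'(3) by (intro exI[of _ "Suc t2"]) force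
  qed
  then obtain T where T: "\<And>k. k \<in> ?K \<Longrightarrow> t \<le> T k \<and> k \<in> sender ` responses (ls (C (T k)) i)"
    by (metis mem_Collect_eq)
  have fin: "finite ?K" by (rule finite_subset[of _ "{1..n}"]) (auto simp: correct_proc_def)
  \<comment> \<open>By this time the replies of all correct processes are collected: more than
    \<open>n div 2\<close> senders, against the bound of \<open>reach_responses\<close>.\<close>
  let ?s = "Max (insert t (T ` ?K))"
  have "?K \<subseteq> sender ` responses (ls (C ?s) i)"
  proof
    fix k assume k: "k \<in> ?K"
    then have "T k \<le> ?s" using fin by (intro Max_ge) auto
    then show "k \<in> sender ` responses (ls (C ?s) i)" using T[OF k] mono by blast
  qed
  moreover obtain ph A G W D H where "reach n (ls (C ?s)) (net (C ?s)) ph A G W D H" using reach_at by blast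
  note resp = reach_responses[OF this, of i]
  ultimately have "card ?K \<le> card (sender ` responses (ls (C ?s) i))"
    by (intro card_mono) simp_all
  also have "\<dots> \<le> n div 2" using resp card_image_le le_trans by blast
  finally show False using card_correct by simp
qed

lemma phase_ends:
  assumes "in_phase (C t) i r b" "requested n (C t) i r" "correct_proc n C i"
  shows "\<exists>t'\<ge>t. if b then \<exists>v. Res i v \<in> set (snd (exec_step n (C t') (L t')))
    else in_phase (C (Suc t')) i (r + 1) True \<and> requested n (C (Suc t')) i (r + 1)"
proof -
  \<comment> \<open>The first time with another id; the phase persists until just before it, and the
    step leading to it ends the phase.\<close>
  define s where "s = (LEAST s. t \<le> s \<and> rid (ls (C s) i) \<noteq> r)"
  have s: "t \<le> s" "rid (ls (C s) i) \<noteq> r"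
    using LeastI_ex[of "\<lambda>s. t \<le> s \<and> rid (ls (C s) i) \<noteq> r"] rid_changes[OF assms(2,3)] unfolding s_def by auto
  have before: "rid (ls (C s') i) = r" if "t \<le> s'" "s' < s" for s'
    using not_less_Least[of s' "\<lambda>s. t \<le> s \<and> rid (ls (C s) i) \<noteq> r"] that unfolding s_def by blast
  have phase: "in_phase (C s') i r b" if "t \<le> s'" "s' < s" for s'
    using that
  proof (induction s' rule: dec_induct)
    case base
    then show ?case using assms(1) by simp
  next
    case (step s')
    then show ?case
      using step_in_phase[OF step.IH fair_run.step(1)[OF fair_run_axioms]] before[of "Suc s'"]
      by (simp add: fair_run.step(2)[OF fair_run_axioms])
  qed
  have "s \<noteq> t" using s assms(1) by (auto simp: in_phase_def)
  then obtain t' where t': "s = Suc t'" "t \<le> t'" using s(1) by (cases s) auto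
  obtain ph A G W D H where R: "reach n (ls (C t')) (net (C t')) ph A G W D H" using reach_at by blast
  show ?thesis
    using step_phase_change[OF R phase[OF t'(2)] step(1)[of t']] s(2) t'
    by (intro exI[of _ t']) (cases b; simp add: step(2))
qed

text \<open>A write has only an update phase; a read passes through a query phase first.\<close>

lemma operation_completes:
  assumes i: "correct_proc n C i" and "L t = Invoke i o'"
  shows "\<exists>t'>t. \<exists>v. Res i v \<in> set (snd (exec_step n (C t') (L t')))"
proof -
  obtain ph A G W D H where R: "reach n (ls (C t)) (net (C t)) ph A G W D H" using reach_at by blast
  obtain r b where "in_phase (C (Suc t)) i r b" "requested n (C (Suc t)) i r"
    using step_invoke_phase[OF R] step[of t] assms(2) by metis
  from phase_ends[OF this i] obtain t1 where t1: "t < t1"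
    "if b then \<exists>v. Res i v \<in> set (snd (exec_step n (C t1) (L t1)))
     else in_phase (C (Suc t1)) i (r + 1) True \<and> requested n (C (Suc t1)) i (r + 1)"
    by (auto simp: Suc_le_eq)
  show ?thesis
  proof (cases b)
    case True
    then show ?thesis using t1 by auto
  next
    case False
    then obtain t2 where "Suc t1 \<le> t2" "\<exists>v. Res i v \<in> set (snd (exec_step n (C t2) (L t2)))"
      using phase_ends[of "Suc t1" i "r + 1" True] t1(2) i by auto
    then show ?thesis using t1(1) by (intro exI[of _ t2]) auto
  qed
qed

end

theorem theorem1:
  fixes n f :: nat
  assumes "2 * f < n"
  shows "(\<forall>C L. is_execution n f C L \<longrightarrow> fair_execution n C L \<longrightarrow>
            (\<forall>t i o'. correct_proc n C i \<longrightarrow> L t = Invoke i o' \<longrightarrow>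
               (\<exists>t' > t. \<exists>v. Res i v \<in> set (snd (exec_step n (C t') (L t'))))))
       \<and> (\<forall>as. valid_run n f init_cfg as \<longrightarrow> complete_hist (run_history n init_cfg as) \<longrightarrow>
            seq_consistent (run_history n init_cfg as))"
  using fair_run.operation_completes[OF fair_run.intro[OF _ _ assms]] seq_consistent_run by blast

end
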